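(* Let $N=2g+2$ be even, $g\ge 1$, and let $\mu_1,\dots,\mu_N\in\mathbf{C}$ be distinct. Let $x=(x_1,\dots,x_N)\ne 0$ and $y=(y_1,\dots,y_N)$ in $\mathbf{C}^N$ satisfy $$\sum_i x_i^2=0,\quad \sum_i\mu_ix_i^2=0,\quad \sum_i x_iy_i=0,\quad \sum_i y_i^2=-1,$$ so that $x$ represents a point of $X=\{\sum_i x_i^2=0=\sum_i\mu_ix_i^2\}\subset\mathrm{P}^{N-1}$ and $y$ represents a cotangent vector of $X$ at that point, and assume this cotangent vector is non-zero. Let $W=L^\perp/L$ be the associated vector bundle on $\mathrm{P}^1$, $U\subset W$ its subbundle determined by $y$, and $A$ the meromorphic endomorphism of $W$ defined by the matrix $$A_{ij}=\frac{x_iy_j-y_ix_j}{z-\mu_i}$$ (all as defined in the context). Then the meromorphic Higgs field $\Psi=A\,dz$ induced on the rank $2$ bundle $W/U$ is equivalent to the Higgs field $$\Phi=\sum_{i=1}^N\frac{v_i\otimes v_i}{z-\mu_i}\,dz,\qquad v_i=x_ie_1+y_ie_2,$$ on the rank $2$ bundle $E\cong\mathcal{O}\oplus\mathcal{O}(-1)$ over $\mathrm{P}^1$; that is, there is an isomorphism of vector bundles $W/U\cong E$ over $\mathrm{P}^1$ carrying $\Psi$ to $\Phi$.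
   Context: Higgs field $\Phi$ and bundle $E$. Let $V\cong\mathbf{C}^2$ have symplectic basis $e_1,e_2$, with skew form $\langle\ ,\ \rangle$, and identify $S^2V$ with the Lie algebra of $SL(2,\mathbf{C})$. With respect to the basis $e_1,e_2$, $\Phi$ is given explicitly by $$\Phi(e_1)=\Big(-\sum_{i}\frac{x_iy_i}{z-\mu_i}e_1-\sum_i\frac{y_i^2}{z-\mu_i}e_2\Big)dz,\qquad \Phi(e_2)=\Big(\sum_i\frac{x_i^2}{z-\mu_i}e_1+\sum_i\frac{x_iy_i}{z-\mu_i}e_2\Big)dz.$$ On the trivial bundle with fibre $V$ over $\mathrm{P}^1$, $\Phi$ has simple poles with nilpotent residues at $z=\mu_i$ and at $z=\infty$, the residue at infinity being, up to sign, $v_0\otimes v_0$ with $v_0=e_2$. The bundle $E$ is the Hecke transform at infinity: the subsheaf of sections of the trivial bundle $V\otimes\mathcal{O}$ whose value at $z=\infty$ lies in the line spanned by $v_0=e_2$. Thus $E\cong\mathcal{O}e_2\oplus\mathcal{O}(-1)e_1$, and since $\sum_i\mu_ix_i^2=0$, $\Phi$ becomes a Higgs field $E\to E\otimes K(D)$ with no pole at $\infty$, where $K=K_{\mathrm{P}^1}$ and $D=\mu_1+\cdots+\mu_N$. Bundles $W$ and $U$. Let $L\subset\mathbf{C}^N$ be the line spanned by $x$. For $z\in\mathrm{P}^1$ consider the quadratic form $q_z=\sum_i(z-\mu_i)x_i^2$ of the pencil spanned by the two quadrics (with $q_\infty=\sum_i x_i^2$), and let $L^\perp=\{u\in\mathbf{C}^N:\sum_i(z-\mu_i)x_iu_i=0\}$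 be the orthogonal of $L$ with respect to $q_z$ (at $z=\infty$: $\sum_i x_iu_i=0$). Then $L\subset L^\perp$, and as $z$ varies over $\mathrm{P}^1$, $W=L^\perp/L$ is a vector bundle of rank $N-2=2g$ over $\mathrm{P}^1$, carrying a degenerate $\mathcal{O}(1)$-valued inner product induced by $q_z$. The subspace $\{u:\sum_i x_iu_i=0=\sum_i\mu_ix_iu_i\}/L$, which is the tangent space of $X$ at $x$ tensored with $L$, is independent of $z$ and defines a trivial subbundle of $W$ of rank $N-3$; $U$ is the trivial subbundle of rank $N-4$ given by those $u$ in it with $\sum_i u_iy_i=0$ (the annihilator of the cotangent vector defined by $y$). Endomorphism $A$. The matrix $A$, acting by $u\mapsto (\sum_jA_{ij}u_j)_i$, is skew-adjoint with respect to $q_z$, annihilates $L$ and preserves $L^\perp$, so defines a skew-adjoint meromorphic endomorphism of $W$ with at most simple poles at the $\mu_i$. It annihilates $U$, and hence $\Psi=A\,dz$ induces a meromorphic map $W/U\to (W/U)\otimes K$ with at most simple poles at the $\mu_i$. Cotangent vectors of $X$ at $x$ are represented by $y\in\mathbf{C}^N$ with $\sum_i x_iy_i=0$ modulo the span of $(x_i)$ and $(\mu_ix_i)$; the cotangent vector is non-zero when $y$ is not in this span. *)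

theory Defs
  imports "HOL-Analysis.Analysis"
begin

text \<open>The projective line, with \<^term>\<open>Some z\<close> the finite points and \<^term>\<open>None\<close> the point
  at infinity. Its complex structure is given by the charts \<^term>\<open>Some\<close> and
  \<open>w \<mapsto> 1/w\<close>.\<close>

type_synonym P1 = "complex option"

definition P1_top :: "P1 topology" where
  "P1_top = Alexandroff_compactification euclidean"

definition chart_inf :: "complex \<Rightarrow> P1" where
  "chart_inf w = (if w = 0 then None else Some (1 / w))"

definition regular_on :: "P1 set \<Rightarrow> (P1 \<Rightarrow> complex) \<Rightarrow> bool" where
  "regular_on X f \<longleftrightarrow>
     (\<lambda>z. f (Some z)) holomorphic_on {z. Some z \<in> X} \<and>
     (\<lambda>w. f (chart_inf w)) holomorphic_on {w. chart_inf w \<in> X}"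


text \<open>Vector bundles are represented by their sheaves of sections, that is, as sheaves of modules
  over the structure sheaf. Sections over an open set \<open>X\<close> are functions on \<open>X\<close>
  (\<^const>\<open>undefined\<close> outside \<open>X\<close>), restriction is restriction of functions, and the module
  operations are pointwise; they may depend on the point, since the zero vector
  of a quotient bundle does. \<open>bsects F X\<close> is the module of sections over \<open>X\<close> and is only
  meaningful for open \<open>X\<close>.\<close>

record 'b vbundle =
  badd :: "P1 \<Rightarrow> 'b \<Rightarrow> 'b \<Rightarrow> 'b"
  bscale :: "P1 \<Rightarrow> complex \<Rightarrow> 'b \<Rightarrow> 'b"
  bsects :: "P1 set \<Rightarrow> (P1 \<Rightarrow> 'b) set"

text \<open>The subsheaf of the trivial bundle of those sections whose value at each point \<open>p\<close> lies in
  the subspace \<open>T p\<close>. If the \<open>T p\<close> vary holomorphically with constant dimension this is the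
  sheaf of sections of a subbundle; if the dimension drops at a point it is a Hecke transform.\<close>

definition sub_trivial :: "(P1 \<Rightarrow> (complex^'n) set) \<Rightarrow> (complex^'n) vbundle" where
  "sub_trivial T = \<lparr>
     badd = (\<lambda>p u v. u + v),
     bscale = (\<lambda>p c u. c *s u),
     bsects = (\<lambda>X. {s \<in> extensional X. (\<forall>i. regular_on X (\<lambda>p. s p $ i)) \<and> (\<forall>p\<in>X. s p \<in> T p)})\<rparr>"

definition trivial_bundle :: "(complex^'n) vbundle" where
  "trivial_bundle = sub_trivial (\<lambda>p. UNIV)"

text \<open>The quotient of \<open>F\<close> by the subbundle with fibres \<open>G p\<close>. Its fibre elements are cosets, and
  its sections are the coset-valued functions that locally lift to sections of \<open>F\<close>.
  The summand \<open>b\<close> in the scaling makes \<open>0 \<cdot> A\<close> the zero coset \<open>G p\<close>.\<close>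

definition coset_at :: "'b vbundle \<Rightarrow> (P1 \<Rightarrow> 'b set) \<Rightarrow> P1 \<Rightarrow> 'b \<Rightarrow> 'b set" where
  "coset_at F G p a = {badd F p a b | b. b \<in> G p}"

definition quotient_bundle :: "'b vbundle \<Rightarrow> (P1 \<Rightarrow> 'b set) \<Rightarrow> 'b set vbundle" where
  "quotient_bundle F G = \<lparr>
     badd = (\<lambda>p A B. {badd F p a b | a b. a \<in> A \<and> b \<in> B}),
     bscale = (\<lambda>p c A. {badd F p (bscale F p c a) b | a b. a \<in> A \<and> b \<in> G p}),
     bsects = (\<lambda>X. {s \<in> extensional X. \<forall>p\<in>X. \<exists>Y. openin P1_top Y \<and> p \<in> Y \<and> Y \<subseteq> X \<and>
                      (\<exists>t\<in>bsects F Y. \<forall>q\<in>Y. s q = coset_at F G q (t q))})\<rparr>"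

definition bundle_sum :: "'b vbundle \<Rightarrow> 'c vbundle \<Rightarrow> ('b \<times> 'c) vbundle" where
  "bundle_sum F G = \<lparr>
     badd = (\<lambda>p a b. (badd F p (fst a) (fst b), badd G p (snd a) (snd b))),
     bscale = (\<lambda>p c a. (bscale F p c (fst a), bscale G p c (snd a))),
     bsects = (\<lambda>X. {s \<in> extensional X. (\<lambda>p\<in>X. fst (s p)) \<in> bsects F X \<and>
                                        (\<lambda>p\<in>X. snd (s p)) \<in> bsects G X})\<rparr>"

text \<open>Isomorphisms over the open set \<open>X\<close>: bijections on the sections over every open subset of
  \<open>X\<close> that are linear over the structure sheaf and commute with restriction.\<close>

definition bundle_iso_on ::
  "P1 set \<Rightarrow> 'b vbundle \<Rightarrow> 'c vbundle \<Rightarrow> (P1 set \<Rightarrow> (P1 \<Rightarrow> 'b) \<Rightarrow> (P1 \<Rightarrow> 'c)) \<Rightarrow> bool" where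
  "bundle_iso_on X F G \<phi> \<longleftrightarrow> (\<forall>Y. openin P1_top Y \<and> Y \<subseteq> X \<longrightarrow>
     bij_betw (\<phi> Y) (bsects F Y) (bsects G Y) \<and>
     (\<forall>s\<in>bsects F Y. \<forall>t\<in>bsects F Y.
        \<phi> Y (\<lambda>p\<in>Y. badd F p (s p) (t p)) = (\<lambda>p\<in>Y. badd G p (\<phi> Y s p) (\<phi> Y t p))) \<and>
     (\<forall>f. \<forall>s\<in>bsects F Y. regular_on Y f \<longrightarrow>
        \<phi> Y (\<lambda>p\<in>Y. bscale F p (f p) (s p)) = (\<lambda>p\<in>Y. bscale G p (f p) (\<phi> Y s p))) \<and>
     (\<forall>Z. openin P1_top Z \<and> Z \<subseteq> Y \<longrightarrow>
        (\<forall>s\<in>bsects F Y. \<phi> Z (restrict s Z) = restrict (\<phi> Y s) Z)))"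

abbreviation "bundle_iso \<equiv> bundle_iso_on UNIV"

definition locally_free :: "'r::finite itself \<Rightarrow> 'b vbundle \<Rightarrow> bool" where
  "locally_free r F \<longleftrightarrow> (\<forall>p. \<exists>X \<phi>. openin P1_top X \<and> p \<in> X \<and>
     bundle_iso_on X F (trivial_bundle :: (complex^'r) vbundle) \<phi>)"

abbreviation rank2_bundle :: "'b vbundle \<Rightarrow> bool" where
  "rank2_bundle F \<equiv> locally_free TYPE(2) F"

text \<open>The bundle \<open>\<O>\<close>, and \<open>\<O>(-1)\<close> as the tautological line bundle: \<open>z\<close> is the ratio of the two homogeneous
  coordinates.\<close>

definition O_bundle :: "(complex^1) vbundle" where
  "O_bundle = trivial_bundle"

definition O_minus1_bundle :: "(complex^2) vbundle" where
  "O_minus1_bundle = sub_trivial (\<lambda>p. case p of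
     None \<Rightarrow> vec.span {vector [1, 0]} | Some z \<Rightarrow> vec.span {vector [z, 1]})"


text \<open>A meromorphic Higgs field with at most simple poles at the points of a finite set
  \<open>D \<subseteq> \<complex>\<close>, that is, a linear map \<open>F \<rightarrow> F \<otimes> K(D)\<close>. It is written \<open>B dz\<close>, with \<open>B z\<close> acting on the
  values of sections at \<open>z \<in> \<complex> - D\<close>. A section of \<open>F \<otimes> K(D)\<close> over \<open>X\<close> is
  likewise represented by its coefficient of \<open>dz\<close>, a section of \<open>F\<close> over \<open>X\<close> minus \<open>D\<close> and infinity
  that near each point of \<open>X\<close> is a section of \<open>F\<close> times a local generator of \<open>K(D)\<close>.
  At infinity the generator is \<open>dw = - dz / z\<^sup>2\<close> where \<open>w = 1/z\<close>.\<close>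

definition poles :: "complex set \<Rightarrow> P1 set" where
  "poles D = insert None (Some ` D)"

definition KD_generator :: "complex set \<Rightarrow> P1 \<Rightarrow> complex \<Rightarrow> complex" where
  "KD_generator D p z = (case p of
     None \<Rightarrow> - 1 / z\<^sup>2 | Some a \<Rightarrow> (if a \<in> D then 1 / (z - a) else 1))"

definition KD_sects :: "'b vbundle \<Rightarrow> complex set \<Rightarrow> P1 set \<Rightarrow> (P1 \<Rightarrow> 'b) set" where
  "KD_sects F D X = {t \<in> bsects F (X - poles D). \<forall>p\<in>X. \<exists>Y. openin P1_top Y \<and> p \<in> Y \<and> Y \<subseteq> X \<and>
     (\<exists>s\<in>bsects F Y. \<forall>q\<in>Y - poles D. t q = bscale F q (KD_generator D p (the q)) (s q))}"

definition apply_higgs ::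
  "complex set \<Rightarrow> (complex \<Rightarrow> 'b \<Rightarrow> 'b) \<Rightarrow> P1 set \<Rightarrow> (P1 \<Rightarrow> 'b) \<Rightarrow> (P1 \<Rightarrow> 'b)" where
  "apply_higgs D B X s = (\<lambda>p\<in>X - poles D. B (the p) (s p))"

definition higgs_field :: "'b vbundle \<Rightarrow> complex set \<Rightarrow> (complex \<Rightarrow> 'b \<Rightarrow> 'b) \<Rightarrow> bool" where
  "higgs_field F D B \<longleftrightarrow> (\<forall>X. openin P1_top X \<longrightarrow> (\<forall>s\<in>bsects F X.
     apply_higgs D B X s \<in> KD_sects F D X \<and>
     (\<forall>p\<in>X - poles D.
        (\<forall>t\<in>bsects F X. B (the p) (badd F p (s p) (t p)) = badd F p (B (the p) (s p)) (B (the p) (t p))) \<and>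
        (\<forall>c. B (the p) (bscale F p c (s p)) = bscale F p c (B (the p) (s p))))))"

text \<open>The isomorphism that \<open>\<phi> : F \<rightarrow> G\<close> induces from \<open>F \<otimes> K(D)\<close> to \<open>G \<otimes> K(D)\<close> acts on
  coefficients of \<open>dz\<close> by \<open>\<phi>\<close> over \<open>X - poles D\<close>.\<close>

definition higgs_equivalent ::
  "complex set \<Rightarrow> 'b vbundle \<Rightarrow> (complex \<Rightarrow> 'b \<Rightarrow> 'b) \<Rightarrow> 'c vbundle \<Rightarrow> (complex \<Rightarrow> 'c \<Rightarrow> 'c) \<Rightarrow> bool" where
  "higgs_equivalent D F B G C \<longleftrightarrow> (\<exists>\<phi>. bundle_iso F G \<phi> \<and>
     (\<forall>X. openin P1_top X \<longrightarrow> (\<forall>s\<in>bsects F X.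
        \<phi> (X - poles D) (apply_higgs D B X s) = apply_higgs D C X (\<phi> X s))))"

text \<open>The endomorphism \<open>[a] \<mapsto> [B a]\<close> induced on a quotient. Its value on a coset is again a coset
  only if \<open>B\<close> preserves the subbundle.\<close>

definition quotient_endo ::
  "'b vbundle \<Rightarrow> (P1 \<Rightarrow> 'b set) \<Rightarrow> (complex \<Rightarrow> 'b \<Rightarrow> 'b) \<Rightarrow> complex \<Rightarrow> 'b set \<Rightarrow> 'b set" where
  "quotient_endo F G B z S = {badd F (Some z) (B z a) b | a b. a \<in> S \<and> b \<in> G (Some z)}"


definition pencil_form ::
  "('n::finite \<Rightarrow> complex) \<Rightarrow> P1 \<Rightarrow> complex^'n \<Rightarrow> complex^'n \<Rightarrow> complex" where
  "pencil_form \<mu> p u v = (case p of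
     None \<Rightarrow> (\<Sum>i\<in>UNIV. u $ i * v $ i) | Some z \<Rightarrow> (\<Sum>i\<in>UNIV. (z - \<mu> i) * u $ i * v $ i))"

definition L_space :: "complex^'n \<Rightarrow> (complex^'n) set" where
  "L_space x = vec.span {x}"

definition L_perp :: "('n::finite \<Rightarrow> complex) \<Rightarrow> complex^'n \<Rightarrow> P1 \<Rightarrow> (complex^'n) set" where
  "L_perp \<mu> x p = {u. \<forall>l\<in>L_space x. pencil_form \<mu> p l u = 0}"

definition L_perp_bundle :: "('n::finite \<Rightarrow> complex) \<Rightarrow> complex^'n \<Rightarrow> (complex^'n) vbundle" where
  "L_perp_bundle \<mu> x = sub_trivial (L_perp \<mu> x)"

definition W_bundle :: "('n::finite \<Rightarrow> complex) \<Rightarrow> complex^'n \<Rightarrow> (complex^'n) set vbundle" where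
  "W_bundle \<mu> x = quotient_bundle (L_perp_bundle \<mu> x) (\<lambda>p. L_space x)"

text \<open>The fibres of \<open>U \<subseteq> W\<close>.\<close>

definition U_fibre ::
  "('n::finite \<Rightarrow> complex) \<Rightarrow> complex^'n \<Rightarrow> complex^'n \<Rightarrow> P1 \<Rightarrow> (complex^'n) set set" where
  "U_fibre \<mu> x y p = {coset_at (L_perp_bundle \<mu> x) (\<lambda>p. L_space x) p u | u.
     (\<Sum>i\<in>UNIV. x $ i * u $ i) = 0 \<and> (\<Sum>i\<in>UNIV. \<mu> i * x $ i * u $ i) = 0 \<and>
     (\<Sum>i\<in>UNIV. u $ i * y $ i) = 0}"

definition W_mod_U ::
  "('n::finite \<Rightarrow> complex) \<Rightarrow> complex^'n \<Rightarrow> complex^'n \<Rightarrow> (complex^'n) set set vbundle" where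
  "W_mod_U \<mu> x y = quotient_bundle (W_bundle \<mu> x) (U_fibre \<mu> x y)"

definition A_matrix ::
  "('n::finite \<Rightarrow> complex) \<Rightarrow> complex^'n \<Rightarrow> complex^'n \<Rightarrow> complex \<Rightarrow> complex^'n^'n" where
  "A_matrix \<mu> x y z = (\<chi> i j. (x $ i * y $ j - y $ i * x $ j) / (z - \<mu> i))"

definition A_on_W ::
  "('n::finite \<Rightarrow> complex) \<Rightarrow> complex^'n \<Rightarrow> complex^'n \<Rightarrow> complex \<Rightarrow>
     (complex^'n) set \<Rightarrow> (complex^'n) set" where
  "A_on_W \<mu> x y =
     quotient_endo (L_perp_bundle \<mu> x) (\<lambda>p. L_space x) (\<lambda>z u. A_matrix \<mu> x y z *v u)"

definition Psi ::
  "('n::finite \<Rightarrow> complex) \<Rightarrow> complex^'n \<Rightarrow> complex^'n \<Rightarrow> complex \<Rightarrow>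
     (complex^'n) set set \<Rightarrow> (complex^'n) set set" where
  "Psi \<mu> x y = quotient_endo (W_bundle \<mu> x) (U_fibre \<mu> x y) (A_on_W \<mu> x y)"


text \<open>\<open>V\<close> is \<^typ>\<open>complex^2\<close> with \<open>e\<^sub>1 = vector [1, 0]\<close> and \<open>e\<^sub>2 = vector [0, 1]\<close>. An
  element \<open>v \<otimes> v\<close> of \<open>S\<^sup>2 V\<close> is the endomorphism \<open>u \<mapsto> \<langle>v, u\<rangle> v\<close>, where \<open>\<langle>e\<^sub>1, e\<^sub>2\<rangle> = 1\<close>.\<close>

definition skew :: "complex^2 \<Rightarrow> complex^2 \<Rightarrow> complex" where
  "skew u v = u $ 1 * v $ 2 - u $ 2 * v $ 1"

definition tensor_square :: "complex^2 \<Rightarrow> complex^2 \<Rightarrow> complex^2" where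
  "tensor_square v u = skew v u *s v"

definition e1 :: "complex^2" where "e1 = vector [1, 0]"
definition e2 :: "complex^2" where "e2 = vector [0, 1]"

definition Phi ::
  "('n::finite \<Rightarrow> complex) \<Rightarrow> complex^'n \<Rightarrow> complex^'n \<Rightarrow> complex \<Rightarrow> complex^2 \<Rightarrow> complex^2" where
  "Phi \<mu> x y z u =
     (\<Sum>i\<in>UNIV. (1 / (z - \<mu> i)) *s tensor_square (x $ i *s e1 + y $ i *s e2) u)"

lemma Phi_e1:
  "Phi \<mu> x y z e1 = (- (\<Sum>i\<in>UNIV. x $ i * y $ i / (z - \<mu> i))) *s e1
                  + (- (\<Sum>i\<in>UNIV. (y $ i)\<^sup>2 / (z - \<mu> i))) *s e2"
  by (simp add: Phi_def tensor_square_def skew_def e1_def e2_def vec_eq_iff forall_2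
      sum_negf power2_eq_square field_simps)

lemma Phi_e2:
  "Phi \<mu> x y z e2 = (\<Sum>i\<in>UNIV. (x $ i)\<^sup>2 / (z - \<mu> i)) *s e1
                  + (\<Sum>i\<in>UNIV. x $ i * y $ i / (z - \<mu> i)) *s e2"
  by (simp add: Phi_def tensor_square_def skew_def e1_def e2_def vec_eq_iff forall_2
      power2_eq_square field_simps)

definition E_bundle :: "(complex^2) vbundle" where
  "E_bundle = sub_trivial (\<lambda>p. case p of None \<Rightarrow> vec.span {e2} | Some z \<Rightarrow> UNIV)"

end

theory Submission
  imports Defs "HOL-Complex_Analysis.Cauchy_Integral_Formula"
begin

text \<open>
  For \<open>u \<in> \<complex>\<^sup>N\<close> write \<open>a = \<Sum> x\<^sub>i u\<^sub>i\<close>, \<open>b = \<Sum> \<mu>\<^sub>i x\<^sub>i u\<^sub>i\<close> and \<open>c = \<Sum> u\<^sub>i y\<^sub>i\<close>. The fibre of \<open>L\<^sup>\<bottom>\<close> is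
  cut out by \<open>b = z a\<close> over \<open>z\<close> and by \<open>a = 0\<close> over infinity, and the preimage of \<open>U\<close> in \<open>\<complex>\<^sup>N\<close>
  is the common kernel of \<open>a\<close>, \<open>b\<close> and \<open>c\<close>. It contains \<open>L\<close>, because \<open>\<Sum> x\<^sub>i\<^sup>2 = \<Sum> \<mu>\<^sub>i x\<^sub>i\<^sup>2 = \<Sum> x\<^sub>i y\<^sub>i = 0\<close>. The three functionals are linearly independent (\<open>independent_conormals\<close>: the cotangent
  vector is non-zero, and \<open>x\<close> has two non-zero coordinates). Therefore \<open>u \<mapsto> (c, (b, a))\<close>
  identifies \<open>W/U\<close> with the bundle of those triples in which \<open>(b, a)\<close> lies on the tautological
  line, that is, with \<open>\<O> \<oplus> \<O>(-1)\<close> (\<open>fibrewise_iso_W_mod_U\<close>).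

  The same bundle of triples is isomorphic to \<open>E\<close> by \<open>(c, (b, a)) \<mapsto> a e\<^sub>1 + c e\<^sub>2\<close>
  (\<open>fibrewise_iso_E\<close>): \<open>a\<close> vanishes at infinity, and for every regular \<open>a\<close> that vanishes at infinity the function
  \<open>b = z a\<close> is regular there. Thus \<open>W/U \<rightarrow> E\<close> is \<open>u \<mapsto> \<Sum> u\<^sub>i v\<^sub>i\<close>. The value at infinity of a section of
  \<open>E\<close> does not determine \<open>b\<close>, so this map is bijective on sections but not on values, and its inverse
  is not a map of values. For this reason everything starts from the bundle of triples: the
  isomorphisms from it to \<open>W/U\<close> and to \<open>E\<close> are both given by maps of values, and local triviality and
  Higgs fields can be transported along them.

  The Higgs fields agree because \<open>(A u)\<^sub>i = (x\<^sub>i c - y\<^sub>i a) / (z - \<mu>\<^sub>i)\<close>. Pairing this with \<open>x\<close> and \<open>y\<close>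
  gives \<open>c S\<^sub>x\<^sub>x - a S\<^sub>x\<^sub>y\<close> and \<open>c S\<^sub>x\<^sub>y - a S\<^sub>y\<^sub>y\<close>, where \<open>S\<^sub>x\<^sub>y = \<Sum> x\<^sub>i y\<^sub>i / (z - \<mu>\<^sub>i)\<close> and so on, and these
  are the components of \<open>\<Phi>(a e\<^sub>1 + c e\<^sub>2)\<close> (\<open>pairings_A_matrix\<close>, \<open>Phi_E_projection\<close>). That the common
  Higgs field on triples has no pole at infinity is a consequence of
  \<open>\<Sum> x\<^sub>i\<^sup>2 = \<Sum> \<mu>\<^sub>i x\<^sub>i\<^sup>2 = \<Sum> x\<^sub>i y\<^sub>i = 0\<close>: they make \<open>S\<^sub>x\<^sub>x\<close> vanish to order three and \<open>S\<^sub>x\<^sub>y\<close> to order two at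
  infinity (\<open>higgs_field_Phi_on_triples\<close>).
\<close>

section \<open>Regular functions on the projective line\<close>

lemma chart_inf_nonzero: "w \<noteq> 0 \<Longrightarrow> chart_inf w = Some (1 / w)"
  by (simp add: chart_inf_def)

lemma chart_inf_zero [simp]: "chart_inf 0 = None"
  by (simp add: chart_inf_def)

lemma open_finite_part:
  assumes "openin P1_top X"
  shows "open {z. Some z \<in> X}"
  using assms openin_continuous_map_preimage[OF continuous_map_Some, of euclidean X]
  by (simp add: P1_top_def)

text \<open>Away from \<open>w = 0\<close> this is continuity of \<open>w \<mapsto> 1/w\<close>; a neighbourhood of infinity contains the
  complement of a bounded set, so its preimage contains a disc around \<open>w = 0\<close>.\<close>
lemma open_chart_inf_preimage:
  assumes "openin P1_top X"
  shows "open {w. chart_inf w \<in> X}"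
proof -
  let ?U = "{z. Some z \<in> X}"
  have away: "open {w. w \<noteq> 0 \<and> 1 / w \<in> ?U}"
  proof -
    have "continuous_on (- {0}) (\<lambda>w::complex. 1 / w)"
      by (intro continuous_intros) auto
    then have "open ((\<lambda>w. 1 / w) -` ?U \<inter> - {0})"
      using continuous_open_vimage open_finite_part[OF assms]
      by (metis continuous_on_open_vimage open_Compl finite.emptyI finite_imp_closed finite_insert)
    moreover have "{w. w \<noteq> 0 \<and> 1 / w \<in> ?U} = (\<lambda>w. 1 / w) -` ?U \<inter> - {0}" by auto
    ultimately show ?thesis by simp
  qed
  show ?thesis
  proof (cases "None \<in> X")
    case False
    then have "{w. chart_inf w \<in> X} = {w. w \<noteq> 0 \<and> 1 / w \<in> ?U}"
      by (auto simp: chart_inf_def split: if_splits)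
    then show ?thesis using away by simp
  next
    case True
    then obtain C :: "complex set" where C: "compact C" "X = insert None (Some ` (- C))"
      using assms by (auto simp: P1_top_def openin_Alexandroff_compactification Compl_eq_Diff_UNIV)
    then obtain B where B: "B > 0" "\<And>z. z \<in> C \<Longrightarrow> norm z < B"
      using bounded_pos_less compact_imp_bounded by metis
    have "chart_inf w \<in> X" if "norm w < 1 / B" for w
    proof (cases "w = 0")
      case False
      then have "norm (1 / w) > B"
        using that B(1) by (simp add: norm_divide field_simps)
      then have "1 / w \<notin> C" using B(2) by force
      then show ?thesis using False C by (simp add: chart_inf_def)
    qed (simp add: True)
    then have "ball 0 (1 / B) \<subseteq> {w. chart_inf w \<in> X}"
      by auto
    moreover have "{w. chart_inf w \<in> X} - {0} = {w. w \<noteq> 0 \<and> 1 / w \<in> ?U}"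
      by (auto simp: chart_inf_def)
    moreover have "0 \<in> ball 0 (1 / B)" using B(1) by simp
    ultimately have "{w. chart_inf w \<in> X} = ball 0 (1 / B) \<union> {w. w \<noteq> 0 \<and> 1 / w \<in> ?U}"
      by blast
    moreover have "open (ball 0 (1 / B) \<union> {w. w \<noteq> 0 \<and> 1 / w \<in> ?U})"
      by (intro open_Un open_ball away)
    ultimately show ?thesis by (simp only:)
  qed
qed

lemma topspace_P1_top [simp]: "topspace P1_top = UNIV"
  by (auto simp: P1_top_def notin_range_Some)

lemma openin_P1_top_UNIV [simp]: "openin P1_top UNIV"
  by (metis openin_topspace topspace_P1_top)

lemma openin_P1_top_diff_finite:
  assumes "openin P1_top X" "finite S"
  shows "openin P1_top (X - S)"
proof -
  have "t1_space P1_top"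
    by (simp add: P1_top_def Hausdorff_imp_t1_space)
  then have "closedin P1_top S"
    using assms(2) by (simp add: t1_space_closedin_finite)
  then show ?thesis
    using assms(1) by (rule openin_diff[rotated])
qed

lemma finite_poles [simp]: "finite D \<Longrightarrow> finite (poles D)"
  by (simp add: poles_def)

lemma regular_on_subset: "regular_on X f \<Longrightarrow> Y \<subseteq> X \<Longrightarrow> regular_on Y f"
  unfolding regular_on_def by (auto elim!: holomorphic_on_subset)

lemma regular_on_cong:
  assumes "\<And>p. p \<in> X \<Longrightarrow> f p = g p"
  shows "regular_on X f \<longleftrightarrow> regular_on X g"
  unfolding regular_on_def using assms
  by (intro conj_cong holomorphic_cong) auto

lemma regular_on_const [simp]: "regular_on X (\<lambda>p. c)"
  by (simp add: regular_on_def)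

lemma regular_on_add: "regular_on X f \<Longrightarrow> regular_on X g \<Longrightarrow> regular_on X (\<lambda>p. f p + g p)"
  by (simp add: regular_on_def holomorphic_on_add)

lemma regular_on_diff: "regular_on X f \<Longrightarrow> regular_on X g \<Longrightarrow> regular_on X (\<lambda>p. f p - g p)"
  by (simp add: regular_on_def holomorphic_on_diff)

lemma regular_on_mult: "regular_on X f \<Longrightarrow> regular_on X g \<Longrightarrow> regular_on X (\<lambda>p. f p * g p)"
  by (simp add: regular_on_def holomorphic_on_mult)

lemma regular_on_sum:
  "(\<And>i. i \<in> I \<Longrightarrow> regular_on X (f i)) \<Longrightarrow> regular_on X (\<lambda>p. \<Sum>i\<in>I. f i p)"
  by (simp add: regular_on_def holomorphic_on_sum)

lemmas regular_intros =
  regular_on_const regular_on_add regular_on_diff regular_on_mult regular_on_sum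

text \<open>Sections of a quotient bundle only lift locally; this lets the coordinates of the local
  lifts be glued.\<close>
lemma regular_on_local:
  assumes "\<And>p. p \<in> X \<Longrightarrow> \<exists>Y. openin P1_top Y \<and> p \<in> Y \<and> regular_on Y f"
  shows "regular_on X f"
proof -
  have "(\<lambda>z. f (Some z)) field_differentiable at z within {z. Some z \<in> X}" if "Some z \<in> X" for z
  proof -
    obtain Y where Y: "openin P1_top Y" "Some z \<in> Y" "regular_on Y f"
      using assms \<open>Some z \<in> X\<close> by blast
    then have "(\<lambda>z. f (Some z)) field_differentiable at z"
      using holomorphic_on_imp_differentiable_at[OF _ open_finite_part[OF Y(1)]]
      by (auto simp: regular_on_def)
    then show ?thesis by (rule field_differentiable_at_within)
  qed
  moreover
  have "(\<lambda>w. f (chart_inf w)) field_differentiable at w within {w. chart_inf w \<in> X}"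
    if "chart_inf w \<in> X" for w
  proof -
    obtain Y where Y: "openin P1_top Y" "chart_inf w \<in> Y" "regular_on Y f"
      using assms \<open>chart_inf w \<in> X\<close> by blast
    then have "(\<lambda>w. f (chart_inf w)) field_differentiable at w"
      using holomorphic_on_imp_differentiable_at[OF _ open_chart_inf_preimage[OF Y(1)]]
      by (auto simp: regular_on_def)
    then show ?thesis by (rule field_differentiable_at_within)
  qed
  ultimately show ?thesis by (simp add: regular_on_def holomorphic_on_def)
qed

text \<open>The rational functions that occur below are combinations of \<open>1/(z - m)\<close>. In these the behaviour
  at infinity is visible, since \<open>z / (z - m) = 1 + m / (z - m)\<close>.\<close>
definition simple_pole :: "complex \<Rightarrow> P1 \<Rightarrow> complex" where
  "simple_pole m p = (case p of None \<Rightarrow> 0 | Some z \<Rightarrow> 1 / (z - m))"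

lemma simple_pole_simps [simp]:
  "simple_pole m None = 0" "simple_pole m (Some z) = 1 / (z - m)"
  by (simp_all add: simple_pole_def)

text \<open>In the chart at infinity \<open>1/(z - m)\<close> is \<open>w / (1 - m w)\<close>.\<close>
lemma regular_on_simple_pole:
  assumes "Some m \<notin> X"
  shows "regular_on X (simple_pole m)"
proof -
  have "(\<lambda>z. 1 / (z - m)) holomorphic_on {z. Some z \<in> X}"
    using assms by (intro holomorphic_intros) auto
  moreover
  have *: "w * m \<noteq> 1" if "chart_inf w \<in> X" for w
  proof
    assume "w * m = 1"
    then have "w \<noteq> 0" by auto
    with \<open>w * m = 1\<close> have "1 / w = m" by (simp add: field_simps)
    with \<open>w \<noteq> 0\<close> show False using that assms by (simp add: chart_inf_nonzero)
  qed
  have "(\<lambda>w. w / (1 - w * m)) holomorphic_on {w. chart_inf w \<in> X}"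
    using * by (intro holomorphic_intros) auto
  then have "(\<lambda>w. simple_pole m (chart_inf w)) holomorphic_on {w. chart_inf w \<in> X}"
    by (rule holomorphic_transform) (auto simp: chart_inf_def field_simps)
  ultimately show ?thesis by (simp add: regular_on_def)
qed

lemma regular_on_coordinate:
  assumes "None \<notin> X"
  shows "regular_on X the"
proof -
  have "(\<lambda>w. 1 / w) holomorphic_on {w. chart_inf w \<in> X}"
    using assms by (intro holomorphic_intros) auto
  then have "(\<lambda>w. the (chart_inf w)) holomorphic_on {w. chart_inf w \<in> X}"
    using assms by (elim holomorphic_transform) (auto simp: chart_inf_def)
  then show ?thesis by (simp add: regular_on_def)
qed

text \<open>In the chart at infinity \<open>z f\<close> is \<open>f / w\<close>, and a zero of \<open>f\<close> at \<open>w = 0\<close> can be divided out.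
  This makes a section of the Hecke transform \<open>E\<close> a section of \<open>\<O> \<oplus> \<O>(-1)\<close>.\<close>
lemma regular_on_divide_out_infinity:
  assumes X: "openin P1_top X" and f: "regular_on X f"
    and f_inf: "None \<in> X \<Longrightarrow> f None = 0"
  obtains g where "regular_on X g" "\<And>z. Some z \<in> X \<Longrightarrow> g (Some z) = z * f (Some z)"
proof (cases "None \<in> X")
  case False
  have "regular_on X (\<lambda>p. the p * f p)"
    using f regular_on_coordinate[OF False] by (intro regular_intros)
  then show ?thesis using that by force
next
  case True
  define F where "F w = f (chart_inf w)" for w
  define g where "g p = (case p of None \<Rightarrow> deriv F 0 | Some z \<Rightarrow> z * f (Some z))" for p
  have F: "F holomorphic_on {w. chart_inf w \<in> X}"
    using f by (simp add: regular_on_def F_def[abs_def])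
  have "(\<lambda>w. if w = 0 then deriv F 0 else (F w - F 0) / (w - 0)) holomorphic_on {w. chart_inf w \<in> X}"
    by (rule pole_lemma_open[OF F open_chart_inf_preimage[OF X]])
  then have "(\<lambda>w. g (chart_inf w)) holomorphic_on {w. chart_inf w \<in> X}"
    using f_inf[OF True]
    by (elim holomorphic_transform) (auto simp: g_def F_def chart_inf_nonzero)
  moreover have "(\<lambda>z. z * f (Some z)) holomorphic_on {z. Some z \<in> X}"
    using f by (intro holomorphic_intros) (simp add: regular_on_def)
  ultimately have "regular_on X g"
    by (simp add: regular_on_def g_def)
  then show ?thesis using that by (simp add: g_def)
qed

text \<open>By continuity. Values at infinity are thus determined by values at finite points, which is used
  where a map of values forgets a coordinate at infinity.\<close>
lemma regular_on_eq_at_infinity: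
  assumes X: "openin P1_top X" and f: "regular_on X f" and g: "regular_on X g"
    and eq: "\<And>z. Some z \<in> X \<Longrightarrow> f (Some z) = g (Some z)"
    and p: "p \<in> X"
  shows "f p = g p"
proof (cases p)
  case None
  let ?S = "{w. chart_inf w \<in> X}"
  have S: "open ?S" "0 \<in> ?S"
    using open_chart_inf_preimage[OF X] p None by auto
  have "continuous_on ?S (\<lambda>w. f (chart_inf w) - g (chart_inf w))"
    using f g by (intro continuous_intros holomorphic_on_imp_continuous_on) (auto simp: regular_on_def)
  then have "((\<lambda>w. f (chart_inf w) - g (chart_inf w)) \<longlongrightarrow> f None - g None) (at 0)"
    using S by (metis (no_types, lifting) at_within_open chart_inf_zero continuous_on_def)
  moreover have "\<forall>\<^sub>F w in at 0. w \<in> ?S \<and> w \<noteq> 0"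
    using S eventually_at_in_open[OF S] by (auto elim!: eventually_mono)
  then have "\<forall>\<^sub>F w in at 0. f (chart_inf w) - g (chart_inf w) = 0"
    by eventually_elim (use eq in \<open>auto simp: chart_inf_nonzero\<close>)
  then have "((\<lambda>w. f (chart_inf w) - g (chart_inf w)) \<longlongrightarrow> 0) (at 0)"
    by (rule tendsto_eventually)
  ultimately have "f None - g None = 0"
    by (rule tendsto_unique[rotated]) simp
  then show ?thesis using None by simp
qed (use eq p in auto)

section \<open>Bundle isomorphisms and Higgs fields\<close>

text \<open>An isomorphism is only required to respect sums, multiples and restrictions that are taken in its
  source. Its inverse respects them if the source is closed under these operations.\<close>
definition module_sheaf :: "'b vbundle \<Rightarrow> bool" where
  "module_sheaf F \<longleftrightarrow> (\<forall>X. openin P1_top X \<longrightarrow> (\<forall>s\<in>bsects F X.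
     (\<forall>t\<in>bsects F X. (\<lambda>p\<in>X. badd F p (s p) (t p)) \<in> bsects F X) \<and>
     (\<forall>f. regular_on X f \<longrightarrow> (\<lambda>p\<in>X. bscale F p (f p) (s p)) \<in> bsects F X) \<and>
     (\<forall>Y. openin P1_top Y \<and> Y \<subseteq> X \<longrightarrow> restrict s Y \<in> bsects F Y)))"

lemma module_sheafD:
  assumes "module_sheaf F" "openin P1_top X" "s \<in> bsects F X"
  shows "t \<in> bsects F X \<Longrightarrow> (\<lambda>p\<in>X. badd F p (s p) (t p)) \<in> bsects F X"
    and "regular_on X f \<Longrightarrow> (\<lambda>p\<in>X. bscale F p (f p) (s p)) \<in> bsects F X"
    and "openin P1_top Y \<Longrightarrow> Y \<subseteq> X \<Longrightarrow> restrict s Y \<in> bsects F Y"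
  using assms unfolding module_sheaf_def by blast+

lemma bundle_iso_onD:
  assumes "bundle_iso_on X F G \<phi>" "openin P1_top Y" "Y \<subseteq> X"
  shows "bij_betw (\<phi> Y) (bsects F Y) (bsects G Y)"
    and "s \<in> bsects F Y \<Longrightarrow> t \<in> bsects F Y \<Longrightarrow>
      \<phi> Y (\<lambda>p\<in>Y. badd F p (s p) (t p)) = (\<lambda>p\<in>Y. badd G p (\<phi> Y s p) (\<phi> Y t p))"
    and "s \<in> bsects F Y \<Longrightarrow> regular_on Y f \<Longrightarrow>
      \<phi> Y (\<lambda>p\<in>Y. bscale F p (f p) (s p)) = (\<lambda>p\<in>Y. bscale G p (f p) (\<phi> Y s p))"
    and "openin P1_top Z \<Longrightarrow> Z \<subseteq> Y \<Longrightarrow> s \<in> bsects F Y \<Longrightarrow>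
      \<phi> Z (restrict s Z) = restrict (\<phi> Y s) Z"
    and "s \<in> bsects F Y \<Longrightarrow> \<phi> Y s \<in> bsects G Y"
proof -
  note iso = assms(1)[unfolded bundle_iso_on_def, rule_format, OF conjI[OF assms(2,3)]]
  show bij: "bij_betw (\<phi> Y) (bsects F Y) (bsects G Y)"
    using iso by (rule conjunct1)
  show "s \<in> bsects F Y \<Longrightarrow> t \<in> bsects F Y \<Longrightarrow>
      \<phi> Y (\<lambda>p\<in>Y. badd F p (s p) (t p)) = (\<lambda>p\<in>Y. badd G p (\<phi> Y s p) (\<phi> Y t p))"
    using iso[THEN conjunct2, THEN conjunct1] by blast
  show "s \<in> bsects F Y \<Longrightarrow> regular_on Y f \<Longrightarrow>
      \<phi> Y (\<lambda>p\<in>Y. bscale F p (f p) (s p)) = (\<lambda>p\<in>Y. bscale G p (f p) (\<phi> Y s p))"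
    using iso[THEN conjunct2, THEN conjunct2, THEN conjunct1] by blast
  show "openin P1_top Z \<Longrightarrow> Z \<subseteq> Y \<Longrightarrow> s \<in> bsects F Y \<Longrightarrow>
      \<phi> Z (restrict s Z) = restrict (\<phi> Y s) Z"
    using iso[THEN conjunct2, THEN conjunct2, THEN conjunct2] by blast
  show "s \<in> bsects F Y \<Longrightarrow> \<phi> Y s \<in> bsects G Y"
    using bij by (blast dest: bij_betwE)
qed

lemma bundle_iso_on_subset:
  "bundle_iso_on X F G \<phi> \<Longrightarrow> Y \<subseteq> X \<Longrightarrow> bundle_iso_on Y F G \<phi>"
  unfolding bundle_iso_on_def by (meson order_trans)

lemma bundle_iso_on_trans:
  assumes \<phi>: "bundle_iso_on X F G \<phi>" and \<psi>: "bundle_iso_on X G H \<psi>"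
  shows "bundle_iso_on X F H (\<lambda>Y. \<psi> Y \<circ> \<phi> Y)"
  unfolding bundle_iso_on_def
proof (intro allI impI conjI ballI)
  fix Y assume "openin P1_top Y \<and> Y \<subseteq> X"
  then have Y: "openin P1_top Y" "Y \<subseteq> X" by auto
  note f = bundle_iso_onD[OF \<phi> Y] and g = bundle_iso_onD[OF \<psi> Y]
  show "bij_betw (\<psi> Y \<circ> \<phi> Y) (bsects F Y) (bsects H Y)"
    by (rule bij_betw_trans[OF f(1) g(1)])
  fix s assume s: "s \<in> bsects F Y"
  show "(\<psi> Y \<circ> \<phi> Y) (\<lambda>p\<in>Y. badd F p (s p) (t p)) =
      (\<lambda>p\<in>Y. badd H p ((\<psi> Y \<circ> \<phi> Y) s p) ((\<psi> Y \<circ> \<phi> Y) t p))"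
    if "t \<in> bsects F Y" for t
    using f(2)[OF s that] g(2)[OF f(5)[OF s] f(5)[OF that]] by simp
  show "(\<psi> Y \<circ> \<phi> Y) (\<lambda>p\<in>Y. bscale F p (h p) (s p)) =
      (\<lambda>p\<in>Y. bscale H p (h p) ((\<psi> Y \<circ> \<phi> Y) s p))"
    if "regular_on Y h" for h
    using f(3)[OF s that] g(3)[OF f(5)[OF s] that] by simp
  show "(\<psi> Z \<circ> \<phi> Z) (restrict s Z) = restrict ((\<psi> Y \<circ> \<phi> Y) s) Z"
    if "openin P1_top Z \<and> Z \<subseteq> Y" for Z
    using f(4)[OF _ _ s, of Z] g(4)[OF _ _ f(5)[OF s], of Z] that by simp
qed

lemma bundle_iso_on_inverse:
  assumes F: "module_sheaf F" and \<phi>: "bundle_iso_on X F G \<phi>"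
  shows "bundle_iso_on X G F (\<lambda>Y. inv_into (bsects F Y) (\<phi> Y))"
proof -
  define \<psi> where "\<psi> Y = inv_into (bsects F Y) (\<phi> Y)" for Y
  have \<psi>I: "\<psi> Y t = s" if "openin P1_top Y" "Y \<subseteq> X" "s \<in> bsects F Y" "\<phi> Y s = t" for Y s t
    using bundle_iso_onD(1)[OF \<phi> that(1,2)] that(3,4)
    by (metis \<psi>_def bij_betw_def inv_into_f_f)
  have \<psi>: "\<psi> Y t \<in> bsects F Y" "\<phi> Y (\<psi> Y t) = t"
    if "openin P1_top Y" "Y \<subseteq> X" "t \<in> bsects G Y" for Y t
    using bundle_iso_onD(1)[OF \<phi> that(1,2)] that(3)
    by (auto simp: \<psi>_def bij_betw_def inv_into_into f_inv_into_f)
  have "bundle_iso_on X G F \<psi>"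
    unfolding bundle_iso_on_def
  proof (intro allI impI conjI ballI)
    fix Y assume "openin P1_top Y \<and> Y \<subseteq> X"
    then have Y: "openin P1_top Y" "Y \<subseteq> X" by auto
    note iso = bundle_iso_onD[OF \<phi> Y]
    show "bij_betw (\<psi> Y) (bsects G Y) (bsects F Y)"
      unfolding \<psi>_def by (rule bij_betw_inv_into[OF iso(1)])
    fix s assume s: "s \<in> bsects G Y"
    show "\<psi> Y (\<lambda>p\<in>Y. badd G p (s p) (t p)) = (\<lambda>p\<in>Y. badd F p (\<psi> Y s p) (\<psi> Y t p))"
      if "t \<in> bsects G Y" for t
      using \<psi>[OF Y s] \<psi>[OF Y that] iso(2) module_sheafD(1)[OF F Y(1)] by (intro \<psi>I Y) auto
    show "\<psi> Y (\<lambda>p\<in>Y. bscale G p (f p) (s p)) = (\<lambda>p\<in>Y. bscale F p (f p) (\<psi> Y s p))"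
      if "regular_on Y f" for f
      using \<psi>[OF Y s] that iso(3) module_sheafD(2)[OF F Y(1)] by (intro \<psi>I Y) auto
    show "\<psi> Z (restrict s Z) = restrict (\<psi> Y s) Z" if "openin P1_top Z \<and> Z \<subseteq> Y" for Z
      using \<psi>[OF Y s] that Y iso(4) module_sheafD(3)[OF F Y(1)] by (intro \<psi>I) auto
  qed
  then show ?thesis by (simp add: \<psi>_def[abs_def])
qed

lemma locally_free_transfer:
  fixes r :: "'r::finite itself"
  assumes "module_sheaf F" "bundle_iso F G \<phi>" "locally_free r F"
  shows "locally_free r G"
  unfolding locally_free_def
proof
  fix p
  obtain X \<psi> where X: "openin P1_top X" "p \<in> X"
    and \<psi>: "bundle_iso_on X F (trivial_bundle :: (complex^'r) vbundle) \<psi>"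
    using assms(3) unfolding locally_free_def by blast
  have "bundle_iso_on X G F (\<lambda>Y. inv_into (bsects F Y) (\<phi> Y))"
    by (rule bundle_iso_on_subset[OF bundle_iso_on_inverse[OF assms(1,2)]]) simp
  from bundle_iso_on_trans[OF this \<psi>] X
  show "\<exists>X \<phi>. openin P1_top X \<and> p \<in> X \<and>
      bundle_iso_on X G (trivial_bundle :: (complex^'r) vbundle) \<phi>"
    by blast
qed

definition fibre_map :: "('b \<Rightarrow> 'c) \<Rightarrow> P1 set \<Rightarrow> (P1 \<Rightarrow> 'b) \<Rightarrow> (P1 \<Rightarrow> 'c)" where
  "fibre_map m X s = (\<lambda>p\<in>X. m (s p))"

text \<open>The map \<open>m\<close> acts on values, and is the same at all points; bijectivity is required on sections
  only. On values it may fail at a single point: the map onto \<open>E\<close> below is not injective on the fibre at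
  infinity.\<close>
definition fibrewise_iso_on :: "P1 set \<Rightarrow> 'b vbundle \<Rightarrow> 'c vbundle \<Rightarrow> ('b \<Rightarrow> 'c) \<Rightarrow> bool" where
  "fibrewise_iso_on X F G m \<longleftrightarrow>
     (\<forall>p u v. m (badd F p u v) = badd G p (m u) (m v)) \<and>
     (\<forall>p c u. m (bscale F p c u) = bscale G p c (m u)) \<and>
     (\<forall>Y. openin P1_top Y \<and> Y \<subseteq> X \<longrightarrow> bij_betw (fibre_map m Y) (bsects F Y) (bsects G Y))"

lemma fibre_map_apply [simp]: "p \<in> X \<Longrightarrow> fibre_map m X s p = m (s p)"
  by (simp add: fibre_map_def)

lemma fibrewise_iso_onD:
  assumes "fibrewise_iso_on X F G m"
  shows "m (badd F p u v) = badd G p (m u) (m v)"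
    and "m (bscale F p c u) = bscale G p c (m u)"
    and "openin P1_top Y \<Longrightarrow> Y \<subseteq> X \<Longrightarrow> bij_betw (fibre_map m Y) (bsects F Y) (bsects G Y)"
  using assms unfolding fibrewise_iso_on_def by blast+

lemma bundle_iso_on_fibre_map:
  assumes "fibrewise_iso_on X F G m"
  shows "bundle_iso_on X F G (fibre_map m)"
  unfolding bundle_iso_on_def
  using fibrewise_iso_onD[OF assms]
  by (auto simp: fibre_map_def fun_eq_iff)

text \<open>Linearity of \<open>m\<close> on values carries a presentation of \<open>B s\<close> as a section times a generator of
  \<open>K(D)\<close> to such a presentation of \<open>C (m s)\<close>, on the same open set.\<close>
lemma higgs_field_transfer:
  assumes m: "fibrewise_iso_on UNIV F G m" and B: "higgs_field F D B" and D: "finite D"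
    and intertwine: "\<And>z u. z \<notin> D \<Longrightarrow> C z (m u) = m (B z u)"
  shows "higgs_field G D C"
  unfolding higgs_field_def
proof (intro allI impI ballI conjI)
  fix X t assume X: "openin P1_top X" and "t \<in> bsects G X"
  note lin = fibrewise_iso_onD(1,2)[OF m]
  have onto: "\<exists>s\<in>bsects F X. t = fibre_map m X s" if "t \<in> bsects G X" for t
    using fibrewise_iso_onD(3)[OF m X] that by (auto simp: bij_betw_def)
  have into: "fibre_map m Y s \<in> bsects G Y" if "openin P1_top Y" "s \<in> bsects F Y" for Y s
    using fibrewise_iso_onD(3)[OF m that(1)] that(2) by (auto dest: bij_betwE)
  have off: "the p \<notin> D" if "p \<notin> poles D" for p
    using that by (cases p) (auto simp: poles_def)
  obtain s where s: "s \<in> bsects F X" "t = fibre_map m X s"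
    using onto \<open>t \<in> bsects G X\<close> by blast
  let ?X = "X - poles D"
  have X': "openin P1_top ?X"
    using X D by (simp add: openin_P1_top_diff_finite)
  have Bs: "apply_higgs D B X s \<in> KD_sects F D X"
    using B X s(1) unfolding higgs_field_def by blast
  have Ct: "apply_higgs D C X t = fibre_map m ?X (apply_higgs D B X s)"
    using s(2) intertwine off by (auto simp: apply_higgs_def fibre_map_def fun_eq_iff)
  show "apply_higgs D C X t \<in> KD_sects G D X"
    unfolding KD_sects_def mem_Collect_eq
  proof (intro conjI ballI)
    show "apply_higgs D C X t \<in> bsects G ?X"
      using Bs Ct into[OF X'] by (simp add: KD_sects_def)
    fix p assume "p \<in> X"
    then obtain Y s' where Y: "openin P1_top Y" "p \<in> Y" "Y \<subseteq> X" and s': "s' \<in> bsects F Y"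
      and eq: "\<And>q. q \<in> Y - poles D \<Longrightarrow>
        apply_higgs D B X s q = bscale F q (KD_generator D p (the q)) (s' q)"
      using Bs unfolding KD_sects_def by blast
    have "apply_higgs D C X t q = bscale G q (KD_generator D p (the q)) (fibre_map m Y s' q)"
      if "q \<in> Y - poles D" for q
      using that eq[OF that] Y(3) by (auto simp: Ct lin)
    then show "\<exists>Y. openin P1_top Y \<and> p \<in> Y \<and> Y \<subseteq> X \<and> (\<exists>s\<in>bsects G Y.
        \<forall>q\<in>Y - poles D. apply_higgs D C X t q = bscale G q (KD_generator D p (the q)) (s q))"
      using Y into[OF Y(1) s'] by blast
  qed
  fix p assume p: "p \<in> X - poles D"
  note [simp] = intertwine[OF off, of p] s(2)
  have pX: "p \<in> X" "p \<notin> poles D" using p by auto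
  show "C (the p) (bscale G p c (t p)) = bscale G p c (C (the p) (t p))" for c
    using B X s(1) p pX by (auto simp: higgs_field_def lin[symmetric])
  fix t' assume "t' \<in> bsects G X"
  then obtain s' where s': "s' \<in> bsects F X" "t' = fibre_map m X s'"
    using onto by blast
  then show "C (the p) (badd G p (t p) (t' p)) = badd G p (C (the p) (t p)) (C (the p) (t' p))"
    using B X s(1) p pX by (auto simp: higgs_field_def lin[symmetric])
qed

text \<open>The equivalence is the composite \<open>m2 \<circ> m1\<^sup>-\<^sup>1\<close>, taken on sections, because \<open>m1\<close> may have no
  inverse on values.\<close>
lemma higgs_equivalent_fibrewise_span:
  assumes F: "module_sheaf F" and B: "higgs_field F D B" and D: "finite D"
    and m1: "fibrewise_iso_on UNIV F G1 m1" "\<And>z u. z \<notin> D \<Longrightarrow> C1 z (m1 u) = m1 (B z u)"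
    and m2: "fibrewise_iso_on UNIV F G2 m2" "\<And>z u. z \<notin> D \<Longrightarrow> C2 z (m2 u) = m2 (B z u)"
  shows "higgs_equivalent D G1 C1 G2 C2"
  unfolding higgs_equivalent_def
proof (intro exI conjI allI impI ballI)
  let ?inv = "\<lambda>Y. inv_into (bsects F Y) (fibre_map m1 Y)"
  let ?\<phi> = "\<lambda>Y. fibre_map m2 Y \<circ> ?inv Y"
  show "bundle_iso G1 G2 ?\<phi>"
    by (rule bundle_iso_on_trans[OF bundle_iso_on_inverse[OF F bundle_iso_on_fibre_map[OF m1(1)]]
          bundle_iso_on_fibre_map[OF m2(1)]])
  fix X t assume X: "openin P1_top X" and t: "t \<in> bsects G1 X"
  let ?X = "X - poles D"
  have X': "openin P1_top ?X"
    using X D by (simp add: openin_P1_top_diff_finite)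
  have off: "the p \<notin> D" if "p \<notin> poles D" for p
    using that by (cases p) (auto simp: poles_def)
  have bij: "bij_betw (fibre_map m1 Y) (bsects F Y) (bsects G1 Y)" if "openin P1_top Y" for Y
    using fibrewise_iso_onD(3)[OF m1(1) that] by simp
  obtain s where s: "s \<in> bsects F X" "t = fibre_map m1 X s"
    using bij[OF X] t by (auto simp: bij_betw_def)
  have inv: "?inv Y (fibre_map m1 Y s) = s" if "openin P1_top Y" "s \<in> bsects F Y" for Y s
    using bij[OF that(1)] that(2) by (simp add: bij_betw_inv_into_left)
  have Bs: "apply_higgs D B X s \<in> bsects F ?X"
    using B X s(1) unfolding higgs_field_def KD_sects_def by blast
  have "apply_higgs D C1 X t = fibre_map m1 ?X (apply_higgs D B X s)"
    using s(2) m1(2) off by (auto simp: apply_higgs_def fibre_map_def fun_eq_iff)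
  then have "?\<phi> ?X (apply_higgs D C1 X t) = fibre_map m2 ?X (apply_higgs D B X s)"
    using inv[OF X' Bs] by simp
  also have "\<dots> = apply_higgs D C2 X (fibre_map m2 X s)"
    using m2(2) off by (auto simp: apply_higgs_def fibre_map_def fun_eq_iff)
  also have "fibre_map m2 X s = ?\<phi> X t"
    using inv[OF X s(1)] s(2) by simp
  finally show "?\<phi> ?X (apply_higgs D C1 X t) = apply_higgs D C2 X (?\<phi> X t)" .
qed

section \<open>The bundle of triples\<close>

abbreviation O_plus_O_minus1 :: "((complex^1) \<times> (complex^2)) vbundle" where
  "O_plus_O_minus1 \<equiv> bundle_sum O_bundle O_minus1_bundle"

text \<open>Values of sections of \<open>\<O> \<oplus> \<O>(-1)\<close>. The arguments are in the order in which they stand in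
  the pair: \<open>c\<close> is the coordinate in \<open>\<O>\<close>, and \<open>(b, a)\<close> lies on the tautological line, on
  which \<open>b/a\<close> is the coordinate \<open>z\<close>.\<close>
definition triple :: "complex \<Rightarrow> complex \<Rightarrow> complex \<Rightarrow> (complex^1) \<times> (complex^2)" where
  "triple c b a = (vec c, vector [b, a])"

lemma triple_simps [simp]:
  "fst (triple c b a) $ 1 = c" "snd (triple c b a) $ 1 = b" "snd (triple c b a) $ 2 = a"
  by (simp_all add: triple_def)

lemma triple_eqI:
  "fst h $ 1 = fst h' $ 1 \<Longrightarrow> snd h $ 1 = snd h' $ 1 \<Longrightarrow> snd h $ 2 = snd h' $ 2 \<Longrightarrow> h = h'"
  for h h' :: "(complex^1) \<times> (complex^2)"
  by (auto simp: prod_eq_iff vec_eq_iff forall_1 forall_2)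

definition on_tautological_line :: "P1 \<Rightarrow> complex \<Rightarrow> complex \<Rightarrow> bool" where
  "on_tautological_line p b a \<longleftrightarrow> (case p of None \<Rightarrow> a = 0 | Some z \<Rightarrow> b = z * a)"

lemma on_tautological_line_simps [simp]:
  "on_tautological_line None b a \<longleftrightarrow> a = 0"
  "on_tautological_line (Some z) b a \<longleftrightarrow> b = z * a"
  by (simp_all add: on_tautological_line_def)

lemma on_tautological_line_add:
  "on_tautological_line p b a \<Longrightarrow> on_tautological_line p b' a' \<Longrightarrow>
    on_tautological_line p (b + b') (a + a')"
  by (cases p) (auto simp: algebra_simps)

lemma on_tautological_line_mult:
  "on_tautological_line p b a \<Longrightarrow> on_tautological_line p (c * b) (c * a)"
  by (cases p) auto

lemma span_vector2:
  "v \<in> vec.span {vector [k, l] :: complex^2} \<longleftrightarrow> (\<exists>c. v $ 1 = c * k \<and> v $ 2 = c * l)"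
  by (auto simp: vec.span_singleton vec_eq_iff forall_2)

lemma O_minus1_fibre:
  "v \<in> (case p of None \<Rightarrow> vec.span {vector [1, 0]} | Some z \<Rightarrow> vec.span {vector [z, 1]}) \<longleftrightarrow>
     on_tautological_line p (v $ 1) (v $ 2)"
  for v :: "complex^2"
  by (cases p) (auto simp: span_vector2)

lemma badd_O_plus_O_minus1 [simp]: "badd O_plus_O_minus1 p u v = u + v"
  by (simp add: bundle_sum_def O_bundle_def O_minus1_bundle_def trivial_bundle_def sub_trivial_def
      prod_eq_iff)

lemma bscale_O_plus_O_minus1 [simp]: "bscale O_plus_O_minus1 p c u = (c *s fst u, c *s snd u)"
  by (simp add: bundle_sum_def O_bundle_def O_minus1_bundle_def trivial_bundle_def sub_trivial_def)

lemma bsects_O_plus_O_minus1: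
  "s \<in> bsects O_plus_O_minus1 X \<longleftrightarrow> s \<in> extensional X \<and>
     regular_on X (\<lambda>p. fst (s p) $ 1) \<and> regular_on X (\<lambda>p. snd (s p) $ 1) \<and>
     regular_on X (\<lambda>p. snd (s p) $ 2) \<and>
     (\<forall>p\<in>X. on_tautological_line p (snd (s p) $ 1) (snd (s p) $ 2))"
  by (simp add: bundle_sum_def O_bundle_def O_minus1_bundle_def trivial_bundle_def
      sub_trivial_def O_minus1_fibre forall_2 cong: regular_on_cong)

lemma restrict_in_bsects_O_plus_O_minus1:
  "restrict s X \<in> bsects O_plus_O_minus1 X \<longleftrightarrow>
     regular_on X (\<lambda>p. fst (s p) $ 1) \<and> regular_on X (\<lambda>p. snd (s p) $ 1) \<and>
     regular_on X (\<lambda>p. snd (s p) $ 2) \<and>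
     (\<forall>p\<in>X. on_tautological_line p (snd (s p) $ 1) (snd (s p) $ 2))"
  by (simp add: bsects_O_plus_O_minus1 cong: regular_on_cong)

lemma module_sheaf_O_plus_O_minus1: "module_sheaf O_plus_O_minus1"
  unfolding module_sheaf_def
proof (intro allI impI ballI conjI)
  fix X s assume s: "s \<in> bsects O_plus_O_minus1 X"
  note regs = s[unfolded bsects_O_plus_O_minus1]
  show "(\<lambda>p\<in>X. badd O_plus_O_minus1 p (s p) (t p)) \<in> bsects O_plus_O_minus1 X"
    if "t \<in> bsects O_plus_O_minus1 X" for t
    using regs that unfolding restrict_in_bsects_O_plus_O_minus1 bsects_O_plus_O_minus1
    by (simp add: regular_on_add on_tautological_line_add cong: regular_on_cong)
  show "(\<lambda>p\<in>X. bscale O_plus_O_minus1 p (f p) (s p)) \<in> bsects O_plus_O_minus1 X"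
    if "regular_on X f" for f
    using regs that unfolding restrict_in_bsects_O_plus_O_minus1
    by (simp add: regular_on_mult on_tautological_line_mult cong: regular_on_cong)
  show "restrict s Y \<in> bsects O_plus_O_minus1 Y" if "openin P1_top Y \<and> Y \<subseteq> X" for Y
    using regs that unfolding restrict_in_bsects_O_plus_O_minus1
    by (auto intro: regular_on_subset)
qed

lemma bsects_trivial:
  "s \<in> bsects trivial_bundle X \<longleftrightarrow> s \<in> extensional X \<and> (\<forall>i. regular_on X (\<lambda>p. s p $ i))"
  by (simp add: trivial_bundle_def sub_trivial_def)

lemma restrict_in_bsects_trivial:
  "restrict s X \<in> bsects trivial_bundle X \<longleftrightarrow> (\<forall>i. regular_on X (\<lambda>p. s p $ i))"
  by (simp add: bsects_trivial cong: regular_on_cong)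

text \<open>On the tautological line \<open>a\<close> is a coordinate over the finite points, with \<open>b = z a\<close>, and \<open>b\<close> is
  a coordinate away from \<open>z = 0\<close>, with \<open>a = b / z\<close>. These are the two local trivialisations.\<close>
lemma fibrewise_iso_on_finite_part:
  "fibrewise_iso_on (- {None}) O_plus_O_minus1 trivial_bundle
     (\<lambda>h. vector [fst h $ 1, snd h $ 2] :: complex^2)"
  (is "fibrewise_iso_on _ _ _ ?m")
  unfolding fibrewise_iso_on_def
proof (intro conjI allI impI)
  fix Y assume "openin P1_top Y \<and> Y \<subseteq> - {None}"
  then have Y: "None \<notin> Y" by auto
  let ?n = "\<lambda>t::P1 \<Rightarrow> complex^2. \<lambda>p\<in>Y. triple (t p $ 1) (the p * t p $ 2) (t p $ 2)"
  show "bij_betw (fibre_map ?m Y) (bsects O_plus_O_minus1 Y) (bsects trivial_bundle Y)"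
  proof (rule bij_betw_byWitness[where f' = ?n])
    show "\<forall>s\<in>bsects O_plus_O_minus1 Y. ?n (fibre_map ?m Y s) = s"
    proof
      fix s assume s: "s \<in> bsects O_plus_O_minus1 Y"
      show "?n (fibre_map ?m Y s) = s"
      proof (rule extensionalityI[of _ Y])
        show "?n (fibre_map ?m Y s) p = s p" if "p \<in> Y" for p
          using s that Y unfolding bsects_O_plus_O_minus1
          by (cases p) (auto intro!: triple_eqI)
      qed (use s in \<open>auto simp: bsects_O_plus_O_minus1\<close>)
    qed
    show "\<forall>t\<in>bsects trivial_bundle Y. fibre_map ?m Y (?n t) = t"
    proof
      fix t :: "P1 \<Rightarrow> complex^2" assume t: "t \<in> bsects trivial_bundle Y"
      show "fibre_map ?m Y (?n t) = t"
      proof (rule extensionalityI[of _ Y])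
        show "fibre_map ?m Y (?n t) p = t p" if "p \<in> Y" for p
          using that by (simp add: vec_eq_iff forall_2)
      qed (use t in \<open>auto simp: bsects_trivial fibre_map_def\<close>)
    qed
    show "fibre_map ?m Y ` bsects O_plus_O_minus1 Y \<subseteq> bsects trivial_bundle Y"
      by (auto simp: bsects_O_plus_O_minus1 fibre_map_def restrict_in_bsects_trivial forall_2)
    show "?n ` bsects trivial_bundle Y \<subseteq> bsects O_plus_O_minus1 Y"
    proof (rule image_subsetI)
      fix t :: "P1 \<Rightarrow> complex^2" assume t: "t \<in> bsects trivial_bundle Y"
      have "on_tautological_line p (the p * t p $ 2) (t p $ 2)" if "p \<in> Y" for p
        using that Y by (cases p) auto
      then show "?n t \<in> bsects O_plus_O_minus1 Y"
        using t Y unfolding restrict_in_bsects_O_plus_O_minus1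
        by (auto simp: bsects_trivial intro!: regular_on_mult regular_on_coordinate)
    qed
  qed
qed (simp_all add: trivial_bundle_def sub_trivial_def vec_eq_iff forall_2)

lemma fibrewise_iso_on_away_from_zero:
  "fibrewise_iso_on (- {Some 0}) O_plus_O_minus1 trivial_bundle
     (\<lambda>h. vector [fst h $ 1, snd h $ 1] :: complex^2)"
  (is "fibrewise_iso_on _ _ _ ?m")
  unfolding fibrewise_iso_on_def
proof (intro conjI allI impI)
  fix Y assume "openin P1_top Y \<and> Y \<subseteq> - {Some 0}"
  then have Y: "Some 0 \<notin> Y" by auto
  let ?n = "\<lambda>t::P1 \<Rightarrow> complex^2. \<lambda>p\<in>Y. triple (t p $ 1) (t p $ 2) (simple_pole 0 p * t p $ 2)"
  have line_iff: "on_tautological_line p b a \<longleftrightarrow> a = simple_pole 0 p * b" if "p \<in> Y" for p a b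
    using that Y by (cases p) (auto simp: field_simps)
  show "bij_betw (fibre_map ?m Y) (bsects O_plus_O_minus1 Y) (bsects trivial_bundle Y)"
  proof (rule bij_betw_byWitness[where f' = ?n])
    show "\<forall>s\<in>bsects O_plus_O_minus1 Y. ?n (fibre_map ?m Y s) = s"
    proof
      fix s assume s: "s \<in> bsects O_plus_O_minus1 Y"
      show "?n (fibre_map ?m Y s) = s"
      proof (rule extensionalityI[of _ Y])
        show "?n (fibre_map ?m Y s) p = s p" if "p \<in> Y" for p
          using s that unfolding bsects_O_plus_O_minus1
          by (auto simp: line_iff intro!: triple_eqI)
      qed (use s in \<open>auto simp: bsects_O_plus_O_minus1\<close>)
    qed
    show "\<forall>t\<in>bsects trivial_bundle Y. fibre_map ?m Y (?n t) = t"
    proof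
      fix t :: "P1 \<Rightarrow> complex^2" assume t: "t \<in> bsects trivial_bundle Y"
      show "fibre_map ?m Y (?n t) = t"
      proof (rule extensionalityI[of _ Y])
        show "fibre_map ?m Y (?n t) p = t p" if "p \<in> Y" for p
          using that by (simp add: vec_eq_iff forall_2)
      qed (use t in \<open>auto simp: bsects_trivial fibre_map_def\<close>)
    qed
    show "fibre_map ?m Y ` bsects O_plus_O_minus1 Y \<subseteq> bsects trivial_bundle Y"
      by (auto simp: bsects_O_plus_O_minus1 fibre_map_def restrict_in_bsects_trivial forall_2)
    show "?n ` bsects trivial_bundle Y \<subseteq> bsects O_plus_O_minus1 Y"
      using Y unfolding image_subset_iff restrict_in_bsects_O_plus_O_minus1
      by (auto simp: bsects_trivial line_iff intro!: regular_on_mult regular_on_simple_pole)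
  qed
qed (simp_all add: trivial_bundle_def sub_trivial_def vec_eq_iff forall_2)

lemma rank2_O_plus_O_minus1: "rank2_bundle O_plus_O_minus1"
  unfolding locally_free_def
proof
  fix p
  have "openin P1_top (- {q})" for q
    using openin_P1_top_diff_finite[OF openin_P1_top_UNIV, of "{q}"] by (simp add: Compl_eq_Diff_UNIV)
  then show "\<exists>X \<phi>. openin P1_top X \<and> p \<in> X \<and>
      bundle_iso_on X O_plus_O_minus1 (trivial_bundle :: (complex^2) vbundle) \<phi>"
    using bundle_iso_on_fibre_map[OF fibrewise_iso_on_finite_part]
      bundle_iso_on_fibre_map[OF fibrewise_iso_on_away_from_zero]
    by (cases p) blast+
qed

section \<open>The bundle E\<close>

definition E_projection :: "(complex^1) \<times> (complex^2) \<Rightarrow> complex^2" where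
  "E_projection h = vector [snd h $ 2, fst h $ 1]"

lemma bsects_E:
  "e \<in> bsects E_bundle X \<longleftrightarrow> e \<in> extensional X \<and> regular_on X (\<lambda>p. e p $ 1) \<and>
     regular_on X (\<lambda>p. e p $ 2) \<and> (None \<in> X \<longrightarrow> e None $ 1 = 0)"
proof -
  have "v \<in> (case p of None \<Rightarrow> vec.span {e2} | Some z \<Rightarrow> UNIV) \<longleftrightarrow> (p = None \<longrightarrow> v $ 1 = 0)"
    for v and p :: P1
    by (cases p) (simp_all add: e2_def span_vector2)
  then show ?thesis
    by (auto simp: E_bundle_def sub_trivial_def forall_2)
qed

text \<open>Forgetting \<open>b\<close> loses nothing on sections: away from infinity \<open>b = z a\<close>, and the value at infinity
  is the limit. Every section of \<open>E\<close> is obtained, because its first coordinate vanishes at infinity,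
  so that \<open>z a\<close> extends.\<close>
lemma fibrewise_iso_E: "fibrewise_iso_on UNIV O_plus_O_minus1 E_bundle E_projection"
  unfolding fibrewise_iso_on_def
proof (intro conjI allI impI)
  fix X :: "P1 set" assume "openin P1_top X \<and> X \<subseteq> UNIV"
  then have X: "openin P1_top X" by simp
  have into: "fibre_map E_projection X s \<in> bsects E_bundle X"
    if "s \<in> bsects O_plus_O_minus1 X" for s
  proof -
    have "regular_on X (\<lambda>p. fibre_map E_projection X s p $ 1)"
      "regular_on X (\<lambda>p. fibre_map E_projection X s p $ 2)"
      using that by (auto simp: bsects_O_plus_O_minus1 E_projection_def
          cong: regular_on_cong)
    then show ?thesis
      using that by (auto simp: bsects_E bsects_O_plus_O_minus1 E_projection_def fibre_map_def)
  qed
  have "inj_on (fibre_map E_projection X) (bsects O_plus_O_minus1 X)"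
  proof (rule inj_onI)
    fix s t assume s: "s \<in> bsects O_plus_O_minus1 X" and t: "t \<in> bsects O_plus_O_minus1 X"
      and eq: "fibre_map E_projection X s = fibre_map E_projection X t"
    have ac: "snd (s p) $ 2 = snd (t p) $ 2" "fst (s p) $ 1 = fst (t p) $ 1" if "p \<in> X" for p
      using fun_cong[OF eq, of p] that by (auto simp: E_projection_def vec_eq_iff forall_2)
    have "snd (s (Some z)) $ 1 = snd (t (Some z)) $ 1" if "Some z \<in> X" for z
      using s t ac(1)[OF that] that by (force simp: bsects_O_plus_O_minus1)
    then have b: "snd (s p) $ 1 = snd (t p) $ 1" if "p \<in> X" for p
      using s t that regular_on_eq_at_infinity[OF X, of "\<lambda>p. snd (s p) $ 1" "\<lambda>p. snd (t p) $ 1"]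
      by (auto simp: bsects_O_plus_O_minus1)
    show "s = t"
      using s t by (intro extensionalityI[of _ X] triple_eqI ac b) (auto simp: bsects_O_plus_O_minus1)
  qed
  moreover have "e \<in> fibre_map E_projection X ` bsects O_plus_O_minus1 X"
    if e: "e \<in> bsects E_bundle X" for e
  proof -
    obtain b where b: "regular_on X b" "\<And>z. Some z \<in> X \<Longrightarrow> b (Some z) = z * e (Some z) $ 1"
      using regular_on_divide_out_infinity[OF X, of "\<lambda>p. e p $ 1"] e by (auto simp: bsects_E)
    let ?s = "\<lambda>p\<in>X. triple (e p $ 2) (b p) (e p $ 1)"
    have "on_tautological_line p (b p) (e p $ 1)" if "p \<in> X" for p
      using e b(2) that by (cases p) (auto simp: bsects_E)
    then have "?s \<in> bsects O_plus_O_minus1 X"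
      using e b(1) unfolding restrict_in_bsects_O_plus_O_minus1 by (auto simp: bsects_E)
    moreover have "e = fibre_map E_projection X ?s"
    proof (rule extensionalityI[of _ X])
      show "e p = fibre_map E_projection X ?s p" if "p \<in> X" for p
        using that by (simp add: E_projection_def vec_eq_iff forall_2)
    qed (use e in \<open>auto simp: bsects_E fibre_map_def\<close>)
    ultimately show ?thesis by blast
  qed
  ultimately show "bij_betw (fibre_map E_projection X) (bsects O_plus_O_minus1 X) (bsects E_bundle X)"
    using into by (auto simp: bij_betw_def)
qed (simp_all add: E_bundle_def sub_trivial_def E_projection_def vec_eq_iff forall_2)

section \<open>The Higgs field on triples\<close>

definition pole_sum :: "('n::finite \<Rightarrow> complex) \<Rightarrow> ('n \<Rightarrow> complex) \<Rightarrow> complex \<Rightarrow> complex" where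
  "pole_sum \<mu> k z = (\<Sum>i\<in>UNIV. k i / (z - \<mu> i))"

text \<open>The product of \<open>z - m\<close> and \<open>\<Sum> k\<^sub>i / (z - \<mu>\<^sub>i)\<close>, extended over \<open>m\<close> and over infinity. It is regular
  there because \<open>(z - m) / (z - \<mu>\<^sub>i) = 1 + (\<mu>\<^sub>i - m) / (z - \<mu>\<^sub>i)\<close>, where the last term drops out for
  \<open>\<mu>\<^sub>i = m\<close>.\<close>
definition scaled_pole_sum ::
  "('n::finite \<Rightarrow> complex) \<Rightarrow> ('n \<Rightarrow> complex) \<Rightarrow> complex \<Rightarrow> P1 \<Rightarrow> complex" where
  "scaled_pole_sum \<mu> k m p = (\<Sum>i\<in>UNIV. k i * (1 + (\<mu> i - m) * simple_pole (\<mu> i) p))"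

lemma scaled_pole_sum_Some:
  assumes "z \<notin> range \<mu>"
  shows "scaled_pole_sum \<mu> k m (Some z) = (z - m) * pole_sum \<mu> k z"
proof -
  have "k i * (1 + (\<mu> i - m) * (1 / (z - \<mu> i))) = (z - m) * (k i / (z - \<mu> i))" for i
  proof -
    have "z - \<mu> i \<noteq> 0" using assms by auto
    then show ?thesis by (simp add: divide_simps)
  qed
  then show ?thesis
    by (simp add: scaled_pole_sum_def pole_sum_def sum_distrib_left)
qed

text \<open>The first step of the expansion at infinity: each vanishing moment of \<open>k\<close> allows one further
  factor \<open>z\<close> to be absorbed.\<close>
lemma mult_pole_sum:
  assumes "z \<notin> range \<mu>" "(\<Sum>i\<in>UNIV. k i) = 0"
  shows "z * pole_sum \<mu> k z = pole_sum \<mu> (\<lambda>i. \<mu> i * k i) z"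
proof -
  have "z * (k i / (z - \<mu> i)) = k i + \<mu> i * k i / (z - \<mu> i)" for i
  proof -
    have "z - \<mu> i \<noteq> 0" using assms(1) by auto
    then show ?thesis by (simp add: divide_simps) (simp add: algebra_simps)
  qed
  then show ?thesis
    by (simp add: pole_sum_def sum_distrib_left sum.distrib assms(2))
qed

lemma regular_on_scaled_pole_sum:
  assumes "\<And>i. Some (\<mu> i) \<in> X \<Longrightarrow> \<mu> i = m"
  shows "regular_on X (scaled_pole_sum \<mu> k m)"
proof -
  have "regular_on X (\<lambda>p. k i * (1 + (\<mu> i - m) * simple_pole (\<mu> i) p))" for i
  proof (cases "Some (\<mu> i) \<in> X")
    case True
    then show ?thesis using assms by simp
  next
    case False
    then show ?thesis by (intro regular_intros regular_on_simple_pole)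
  qed
  then have "regular_on X (\<lambda>p. scaled_pole_sum \<mu> k m p)"
    unfolding scaled_pole_sum_def by (intro regular_on_sum)
  then show ?thesis by simp
qed

lemma regular_on_pole_sum:
  assumes "None \<notin> X" "\<And>i. Some (\<mu> i) \<notin> X"
  shows "regular_on X (\<lambda>p. pole_sum \<mu> k (the p))"
proof -
  have "regular_on X (\<lambda>p. \<Sum>i\<in>UNIV. k i * simple_pole (\<mu> i) p)"
    using assms(2) by (intro regular_intros regular_on_simple_pole)
  moreover have "(\<Sum>i\<in>UNIV. k i * simple_pole (\<mu> i) p) = pole_sum \<mu> k (the p)" if "p \<in> X" for p
    using that assms(1) by (cases p) (auto simp: pole_sum_def)
  ultimately show ?thesis by (simp cong: regular_on_cong)
qed

text \<open>The Higgs field \<open>\<Phi>\<close> acting on \<open>a e\<^sub>1 + c e\<^sub>2\<close>; the coordinate \<open>b\<close> is determined by the condition that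
  the result lie on the tautological line.\<close>
definition Phi_on_triples ::
  "('n::finite \<Rightarrow> complex) \<Rightarrow> complex^'n \<Rightarrow> complex^'n \<Rightarrow> complex \<Rightarrow>
     (complex^1) \<times> (complex^2) \<Rightarrow> (complex^1) \<times> (complex^2)" where
  "Phi_on_triples \<mu> x y z h =
     (let c = fst h $ 1; a = snd h $ 2;
          a' = c * pole_sum \<mu> (\<lambda>i. (x $ i)\<^sup>2) z - a * pole_sum \<mu> (\<lambda>i. x $ i * y $ i) z
      in triple (c * pole_sum \<mu> (\<lambda>i. x $ i * y $ i) z - a * pole_sum \<mu> (\<lambda>i. (y $ i)\<^sup>2) z)
           (z * a') a')"

text \<open>Away from infinity the formula for \<open>Phi_on_triples\<close> produces sections from any regular coefficients.
  It is applied to the coefficients \<open>S\<close> themselves off the poles, and to \<open>(z - \<mu>\<^sub>i) S\<close> near \<open>\<mu>\<^sub>i\<close>.\<close>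
lemma section_from_coefficients:
  assumes "h \<in> bsects O_plus_O_minus1 X" "Y \<subseteq> X" "None \<notin> Y"
    and "regular_on Y S\<^sub>x\<^sub>x" "regular_on Y S\<^sub>x\<^sub>y" "regular_on Y S\<^sub>y\<^sub>y"
  shows "(\<lambda>p\<in>Y. triple (fst (h p) $ 1 * S\<^sub>x\<^sub>y p - snd (h p) $ 2 * S\<^sub>y\<^sub>y p)
      (the p * (fst (h p) $ 1 * S\<^sub>x\<^sub>x p - snd (h p) $ 2 * S\<^sub>x\<^sub>y p))
      (fst (h p) $ 1 * S\<^sub>x\<^sub>x p - snd (h p) $ 2 * S\<^sub>x\<^sub>y p)) \<in> bsects O_plus_O_minus1 Y"
proof -
  have h: "regular_on Y (\<lambda>p. fst (h p) $ 1)" "regular_on Y (\<lambda>p. snd (h p) $ 2)"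
    using assms(1,2) by (auto simp: bsects_O_plus_O_minus1 intro: regular_on_subset)
  have line: "on_tautological_line p (the p * a) a" if "p \<in> Y" for p a
    using that assms(3) by (cases p) auto
  show ?thesis
    unfolding restrict_in_bsects_O_plus_O_minus1 triple_simps
    using h assms(3-) line by (auto intro!: regular_intros regular_on_coordinate)
qed

text \<open>At \<open>\<mu>\<^sub>i\<close> the factor \<open>z - \<mu>\<^sub>i\<close> cancels the pole. At infinity the coefficient of \<open>dw\<close> is \<open>-z\<^sup>2\<close> times that
  of \<open>dz\<close>. By the relations, \<open>z\<^sup>2 S\<^sub>x\<^sub>y\<close> and \<open>z\<^sup>3 S\<^sub>x\<^sub>x\<close> are regular at infinity, and one factor \<open>z\<close> of
  \<open>z\<^sup>2 a S\<^sub>y\<^sub>y\<close> is absorbed by \<open>z a = b\<close>.\<close>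
lemma higgs_field_Phi_on_triples:
  fixes \<mu> :: "'n::finite \<Rightarrow> complex"
  assumes xx: "(\<Sum>i\<in>UNIV. (x $ i)\<^sup>2) = 0" and \<mu>xx: "(\<Sum>i\<in>UNIV. \<mu> i * (x $ i)\<^sup>2) = 0"
    and xy: "(\<Sum>i\<in>UNIV. x $ i * y $ i) = 0"
  shows "higgs_field O_plus_O_minus1 (range \<mu>) (Phi_on_triples \<mu> x y)"
  unfolding higgs_field_def
proof (intro allI impI ballI conjI)
  let ?D = "range \<mu>"
  let ?S = "pole_sum \<mu>"
  fix X h assume X: "openin P1_top X" and h: "h \<in> bsects O_plus_O_minus1 X"
  define t where "t = apply_higgs ?D (Phi_on_triples \<mu> x y) X h"
  let ?X = "X - poles ?D"
  have X': "openin P1_top ?X" "None \<notin> ?X"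
    using X by (auto simp: openin_P1_top_diff_finite poles_def)
  have t_eq: "t = (\<lambda>p\<in>?X. Phi_on_triples \<mu> x y (the p) (h p))"
    by (simp add: t_def apply_higgs_def)
  have t: "t \<in> bsects O_plus_O_minus1 ?X"
    unfolding t_eq Phi_on_triples_def Let_def
    by (intro section_from_coefficients[OF h] X' regular_on_pole_sum) (auto simp: poles_def)
  show "apply_higgs ?D (Phi_on_triples \<mu> x y) X h \<in> KD_sects O_plus_O_minus1 ?D X"
    unfolding KD_sects_def mem_Collect_eq t_def[symmetric]
  proof (intro conjI ballI t)
    fix p assume p: "p \<in> X"
    consider (regular) z where "p = Some z" "z \<notin> ?D" | (pole) m where "p = Some m" "m \<in> ?D"
      | (infinity) "p = None"
      by (cases p) auto
    then show "\<exists>Y. openin P1_top Y \<and> p \<in> Y \<and> Y \<subseteq> X \<and> (\<exists>s\<in>bsects O_plus_O_minus1 Y.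
        \<forall>q\<in>Y - poles ?D. t q = bscale O_plus_O_minus1 q (KD_generator ?D p (the q)) (s q))"
    proof cases
      case regular
      then have "p \<in> ?X" using p by (auto simp: poles_def)
      moreover have "KD_generator ?D p z = 1" for z
        using regular by (simp add: KD_generator_def)
      ultimately show ?thesis
        using X' t by (intro exI[of _ ?X] conjI bexI[of _ t]) auto
    next
      case pole
      let ?Y = "X - (poles ?D - {Some m})"
      define s where "s = (\<lambda>q\<in>?Y.
        let c = fst (h q) $ 1; a = snd (h q) $ 2;
          P = \<lambda>k. scaled_pole_sum \<mu> k m q;
          a' = c * P (\<lambda>i. (x $ i)\<^sup>2) - a * P (\<lambda>i. x $ i * y $ i)
        in triple (c * P (\<lambda>i. x $ i * y $ i) - a * P (\<lambda>i. (y $ i)\<^sup>2)) (the q * a') a')"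
      have "s \<in> bsects O_plus_O_minus1 ?Y"
        unfolding s_def Let_def
        by (intro section_from_coefficients[OF h] regular_on_scaled_pole_sum) (auto simp: poles_def)
      moreover have "t q = bscale O_plus_O_minus1 q (KD_generator ?D p (the q)) (s q)"
        if q: "q \<in> ?Y - poles ?D" for q
      proof -
        obtain z where z: "q = Some z" "z \<notin> ?D" "q \<in> ?X"
          using q by (cases q) (auto simp: poles_def)
        then have "z \<noteq> m" using pole by auto
        then have cancel: "(u * ((z - m) * S) - v * ((z - m) * S')) / (z - m) = u * S - v * S'"
            "z * (u * ((z - m) * S) - v * ((z - m) * S')) / (z - m) = z * (u * S - v * S')" for u v S S'
          by (simp_all add: divide_simps) (simp_all add: algebra_simps)
        show ?thesis
          using z q pole by (intro triple_eqI)
            (simp_all add: t_eq s_def Phi_on_triples_def Let_def KD_generator_def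
              scaled_pole_sum_Some cancel)
      qed
      ultimately show ?thesis
        using X p pole
        by (intro exI[of _ ?Y] conjI bexI[of _ s] openin_P1_top_diff_finite) auto
    next
      case infinity
      \<comment> \<open>The point \<open>0\<close> is removed because the generator \<open>-1/z\<^sup>2\<close> of \<open>K\<close> near infinity has a pole there.\<close>
      let ?Y = "X - insert (Some 0) (Some ` ?D)"
      let ?P = "\<lambda>k. scaled_pole_sum \<mu> k 0"
      let ?xy = "\<lambda>i. x $ i * y $ i" and ?xx = "\<lambda>i. (x $ i)\<^sup>2" and ?yy = "\<lambda>i. (y $ i)\<^sup>2"
      let ?\<mu>xy = "\<lambda>i. \<mu> i * ?xy i" and ?\<mu>\<mu>xx = "\<lambda>i. \<mu> i * (\<mu> i * ?xx i)"
      \<comment> \<open>\<open>R\<close> continues \<open>z\<^sup>2 S\<^sub>x\<^sub>x\<close> and vanishes at infinity, so that the new \<open>a\<close> does.\<close>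
      define R where "R p = simple_pole 0 p * ?P ?\<mu>\<mu>xx p" for p
      define s where "s = (\<lambda>q\<in>?Y. triple (snd (h q) $ 1 * ?P ?yy q - fst (h q) $ 1 * ?P ?\<mu>xy q)
        (snd (h q) $ 1 * ?P ?\<mu>xy q - fst (h q) $ 1 * ?P ?\<mu>\<mu>xx q)
        (snd (h q) $ 2 * ?P ?\<mu>xy q - fst (h q) $ 1 * R q))"
      have Y: "?Y \<subseteq> X" "Some 0 \<notin> ?Y" "\<And>i. Some (\<mu> i) \<notin> ?Y" by auto
      have R: "regular_on ?Y R"
        unfolding R_def using Y by (intro regular_intros regular_on_simple_pole regular_on_scaled_pole_sum) auto
      have line: "on_tautological_line q (b * k - c * ?P ?\<mu>\<mu>xx q) (a * k - c * R q)"
        if "q \<in> ?Y" "on_tautological_line q b a" for q a b c k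
        using that by (cases q) (auto simp: R_def algebra_simps)
      have "regular_on ?Y (\<lambda>p. fst (h p) $ 1)" "regular_on ?Y (\<lambda>p. snd (h p) $ 1)"
          "regular_on ?Y (\<lambda>p. snd (h p) $ 2)"
          "\<And>q. q \<in> ?Y \<Longrightarrow> on_tautological_line q (snd (h q) $ 1) (snd (h q) $ 2)"
        using h regular_on_subset[OF _ Y(1)] by (auto simp: bsects_O_plus_O_minus1)
      then have "s \<in> bsects O_plus_O_minus1 ?Y"
        unfolding s_def restrict_in_bsects_O_plus_O_minus1 triple_simps
        by (intro conjI ballI line regular_intros regular_on_scaled_pole_sum R) auto
      moreover have "t q = bscale O_plus_O_minus1 q (KD_generator ?D p (the q)) (s q)"
        if q: "q \<in> ?Y - poles ?D" for q
      proof -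
        obtain z where z: "q = Some z" "z \<notin> ?D" "q \<in> ?X" "q \<in> ?Y" "z \<noteq> 0"
          using q by (cases q) (auto simp: poles_def)
        have b: "snd (h q) $ 1 = z * snd (h q) $ 2"
          using h z by (auto simp: bsects_O_plus_O_minus1)
        have P_yy: "?P ?yy q = z * ?S ?yy z"
          using z by (simp add: scaled_pole_sum_Some)
        have P_xy: "?P ?\<mu>xy q = z\<^sup>2 * ?S ?xy z"
          using z mult_pole_sum[OF z(2) xy] by (simp add: scaled_pole_sum_Some power2_eq_square)
        have P_xx: "?P ?\<mu>\<mu>xx q = z ^ 3 * ?S ?xx z"
          using z mult_pole_sum[OF z(2) xx] mult_pole_sum[OF z(2) \<mu>xx]
          by (simp add: scaled_pole_sum_Some power3_eq_cube)
        have R_q: "R q = z\<^sup>2 * ?S ?xx z"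
          unfolding R_def P_xx using z by (simp add: power3_eq_cube power2_eq_square)
        have t_q: "t q = Phi_on_triples \<mu> x y z (h q)"
          using z by (simp add: t_eq)
        have s_q: "s q = triple
            (z * snd (h q) $ 2 * (z * ?S ?yy z) - fst (h q) $ 1 * (z\<^sup>2 * ?S ?xy z))
            (z * snd (h q) $ 2 * (z\<^sup>2 * ?S ?xy z) - fst (h q) $ 1 * (z ^ 3 * ?S ?xx z))
            (snd (h q) $ 2 * (z\<^sup>2 * ?S ?xy z) - fst (h q) $ 1 * (z\<^sup>2 * ?S ?xx z))"
          using z(4) by (simp add: s_def P_yy P_xy P_xx R_q b)
        have gen: "KD_generator ?D p (the q) = - 1 / z\<^sup>2"
          using z(1) infinity by (simp add: KD_generator_def)
        show ?thesis
          unfolding t_q s_q gen Phi_on_triples_def Let_def using \<open>z \<noteq> 0\<close>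
          by (intro triple_eqI) (simp_all add: field_simps power2_eq_square power3_eq_cube)
      qed
      ultimately show ?thesis
        using X p infinity
        by (intro exI[of _ ?Y] conjI bexI[of _ s] openin_P1_top_diff_finite) auto
    qed
  qed
  fix p assume "p \<in> ?X"
  show "Phi_on_triples \<mu> x y (the p) (badd O_plus_O_minus1 p (h p) (h' p)) =
      badd O_plus_O_minus1 p (Phi_on_triples \<mu> x y (the p) (h p)) (Phi_on_triples \<mu> x y (the p) (h' p))"
    for h'
    by (intro triple_eqI) (simp_all add: Phi_on_triples_def Let_def algebra_simps)
  show "Phi_on_triples \<mu> x y (the p) (bscale O_plus_O_minus1 p c (h p)) =
      bscale O_plus_O_minus1 p c (Phi_on_triples \<mu> x y (the p) (h p))" for c
    by (intro triple_eqI) (simp_all add: Phi_on_triples_def Let_def algebra_simps)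
qed

lemma Phi_E_projection:
  "Phi \<mu> x y z (E_projection h) = E_projection (Phi_on_triples \<mu> x y z h)"
  by (simp add: Phi_def E_projection_def Phi_on_triples_def Let_def tensor_square_def skew_def
      e1_def e2_def pole_sum_def vec_eq_iff forall_2 sum_distrib_left sum_subtractf[symmetric]
      power2_eq_square algebra_simps divide_inverse)

section \<open>Iterated cosets\<close>

definition translate :: "'b::plus set \<Rightarrow> 'b \<Rightarrow> 'b set" where
  "translate S u = (\<lambda>v. u + v) ` S"

lemma translate_eq_iff:
  fixes S :: "(complex^'n) set"
  assumes "vec.subspace S"
  shows "translate S u = translate S v \<longleftrightarrow> u - v \<in> S"
proof
  assume "translate S u = translate S v"
  moreover have "u \<in> translate S u"
    using vec.subspace_0[OF assms] by (force simp: translate_def)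
  ultimately show "u - v \<in> S" by (auto simp: translate_def)
next
  assume uv: "u - v \<in> S"
  have "u + w \<in> translate S v" if "w \<in> S" for w
    using vec.subspace_add[OF assms uv that] unfolding translate_def
    by (rule rev_image_eqI) simp
  moreover have "v + w \<in> translate S u" if "w \<in> S" for w
    using vec.subspace_diff[OF assms that uv] unfolding translate_def
    by (rule rev_image_eqI) simp
  ultimately show "translate S u = translate S v"
    by (auto simp: translate_def)
qed

lemma translate_add:
  fixes S :: "(complex^'n) set"
  assumes "vec.subspace S"
  shows "{a + b | a b. a \<in> translate S u \<and> b \<in> translate S v} = translate S (u + v)"
proof (intro equalityI subsetI)
  fix w assume "w \<in> {a + b | a b. a \<in> translate S u \<and> b \<in> translate S v}"
  then obtain k l where "k \<in> S" "l \<in> S" "w = (u + k) + (v + l)"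
    by (auto simp: translate_def)
  then show "w \<in> translate S (u + v)"
    unfolding translate_def by (intro image_eqI[of _ _ "k + l"] vec.subspace_add[OF assms]) auto
next
  fix w assume "w \<in> translate S (u + v)"
  then obtain k where "k \<in> S" "w = (u + k) + (v + 0)" by (auto simp: translate_def algebra_simps)
  then show "w \<in> {a + b | a b. a \<in> translate S u \<and> b \<in> translate S v}"
    using vec.subspace_0[OF assms] unfolding translate_def by blast
qed

text \<open>The setwise definitions of scaling and of an induced endomorphism on cosets give cosets
  again. The summand from \<open>S\<close> fills up the coset when \<open>f\<close> does not map \<open>S\<close> onto itself.\<close>
lemma translate_image:
  fixes S :: "(complex^'n) set"
  assumes S: "vec.subspace S" and f: "\<And>u v. f (u + v) = f u + f v" "\<And>u. u \<in> S \<Longrightarrow> f u \<in> S"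
  shows "{f a + b | a b. a \<in> translate S u \<and> b \<in> S} = translate S (f u)"
proof (intro equalityI subsetI)
  fix w assume "w \<in> {f a + b | a b. a \<in> translate S u \<and> b \<in> S}"
  then obtain k l where "k \<in> S" "l \<in> S" "w = f u + (f k + l)"
    by (auto simp: translate_def f algebra_simps)
  then show "w \<in> translate S (f u)"
    unfolding translate_def by (intro image_eqI[of _ _ "f k + l"] vec.subspace_add[OF S] f) auto
next
  fix w assume "w \<in> translate S (f u)"
  then obtain l where "l \<in> S" "w = f u + l" by (auto simp: translate_def)
  moreover have "u \<in> translate S u"
    using vec.subspace_0[OF S] by (force simp: translate_def)
  ultimately show "w \<in> {f a + b | a b. a \<in> translate S u \<and> b \<in> S}" by blast
qed

text \<open>A fibre element of a quotient of a quotient: the coset of \<open>u + S\<close> modulo \<open>K/S\<close> is the set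
  of all \<open>u + k + S\<close> with \<open>k \<in> K\<close>.\<close>
definition iterated_coset ::
  "(complex^'n) set \<Rightarrow> (complex^'n) set \<Rightarrow> complex^'n \<Rightarrow> (complex^'n) set set" where
  "iterated_coset S K u = translate S ` translate K u"

text \<open>\<open>(F/S)/(K/S)\<close> is \<open>F/K\<close>.\<close>
lemma iterated_coset_eq_iff:
  assumes S: "vec.subspace S" and K: "vec.subspace K" and "S \<subseteq> K"
  shows "iterated_coset S K u = iterated_coset S K v \<longleftrightarrow> u - v \<in> K"
proof
  have "u \<in> translate K u"
    using vec.subspace_0[OF K] by (force simp: translate_def)
  then have "translate S u \<in> iterated_coset S K u"
    by (simp add: iterated_coset_def)
  also assume "iterated_coset S K u = iterated_coset S K v"
  finally obtain k where k: "k \<in> K" "translate S u = translate S (v + k)"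
    by (auto simp: iterated_coset_def translate_def[of K])
  then have "u - (v + k) \<in> K"
    using translate_eq_iff[OF S] \<open>S \<subseteq> K\<close> by blast
  from vec.subspace_add[OF K this k(1)] show "u - v \<in> K" by simp
next
  assume "u - v \<in> K"
  then show "iterated_coset S K u = iterated_coset S K v"
    using translate_eq_iff[OF K, of u v] by (simp add: iterated_coset_def)
qed

text \<open>Transports an operation on the outer level of an iterated coset to representatives.\<close>
lemma translate_op_image:
  assumes "\<And>a b. a \<in> A \<Longrightarrow> b \<in> B \<Longrightarrow> G (translate S a) (translate S b) = translate S (g a b)"
  shows "{G a b | a b. a \<in> translate S ` A \<and> b \<in> translate S ` B} =
    translate S ` {g a b | a b. a \<in> A \<and> b \<in> B}"
proof (intro equalityI subsetI)
  fix w assume "w \<in> {G a b | a b. a \<in> translate S ` A \<and> b \<in> translate S ` B}"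
  then obtain a b where "a \<in> A" "b \<in> B" "w = translate S (g a b)"
    using assms by auto
  then show "w \<in> translate S ` {g a b | a b. a \<in> A \<and> b \<in> B}" by blast
next
  fix w assume "w \<in> translate S ` {g a b | a b. a \<in> A \<and> b \<in> B}"
  then obtain a b where "a \<in> A" "b \<in> B" "w = G (translate S a) (translate S b)"
    using assms by auto
  then show "w \<in> {G a b | a b. a \<in> translate S ` A \<and> b \<in> translate S ` B}" by blast
qed

section \<open>The quotient W/U\<close>

definition pairings :: "('n::finite \<Rightarrow> complex) \<Rightarrow> complex^'n \<Rightarrow> complex^'n \<Rightarrow>
    complex^'n \<Rightarrow> (complex^1) \<times> (complex^2)" where
  "pairings \<mu> x y u = triple (\<Sum>i\<in>UNIV. u $ i * y $ i) (\<Sum>i\<in>UNIV. \<mu> i * x $ i * u $ i)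
     (\<Sum>i\<in>UNIV. x $ i * u $ i)"

lemma pairings_add: "pairings \<mu> x y (u + v) = pairings \<mu> x y u + pairings \<mu> x y v"
  by (intro triple_eqI) (simp_all add: pairings_def sum.distrib algebra_simps)

lemma pairings_diff: "pairings \<mu> x y (u - v) = pairings \<mu> x y u - pairings \<mu> x y v"
  by (intro triple_eqI) (simp_all add: pairings_def sum_subtractf algebra_simps)

lemma pairings_scale:
  "pairings \<mu> x y (c *s u) = (c *s fst (pairings \<mu> x y u), c *s snd (pairings \<mu> x y u))"
  by (intro triple_eqI) (simp_all add: pairings_def sum_distrib_left algebra_simps)

lemma triple_zero: "triple c b a = 0 \<longleftrightarrow> c = 0 \<and> b = 0 \<and> a = 0"
  by (auto simp: triple_def prod_eq_iff vec_eq_iff forall_2)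

text \<open>This is where the tautological line comes from: \<open>q\<^sub>z(x, u) = z a - b\<close>, and \<open>q\<^sub>\<infinity>(x, u) = a\<close>.\<close>
lemma L_perp_iff:
  "u \<in> L_perp \<mu> x p \<longleftrightarrow>
     on_tautological_line p (snd (pairings \<mu> x y u) $ 1) (snd (pairings \<mu> x y u) $ 2)"
proof -
  have "pencil_form \<mu> p (c *s x) u = c * pencil_form \<mu> p x u" for c
    by (auto simp: pencil_form_def sum_distrib_left algebra_simps split: option.splits)
  then have "u \<in> L_perp \<mu> x p \<longleftrightarrow> pencil_form \<mu> p x u = 0"
    by (auto simp: L_perp_def L_space_def vec.span_singleton dest: spec[of _ 1])
  also have "\<dots> \<longleftrightarrow> on_tautological_line p (snd (pairings \<mu> x y u) $ 1) (snd (pairings \<mu> x y u) $ 2)"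
    by (cases p) (auto simp: pencil_form_def pairings_def sum_subtractf sum_distrib_left algebra_simps)
  finally show ?thesis .
qed

definition U_preimage :: "('n::finite \<Rightarrow> complex) \<Rightarrow> complex^'n \<Rightarrow> complex^'n \<Rightarrow> (complex^'n) set" where
  "U_preimage \<mu> x y = {u. pairings \<mu> x y u = 0}"

lemma subspace_L: "vec.subspace (L_space x)"
  by (simp add: L_space_def vec.subspace_span)

lemma subspace_U_preimage: "vec.subspace (U_preimage \<mu> x y)"
proof (rule vec.subspaceI)
  show "0 \<in> U_preimage \<mu> x y"
    using pairings_diff[of \<mu> x y 0 0] by (simp add: U_preimage_def)
qed (auto simp: U_preimage_def pairings_add pairings_scale zero_prod_def)

lemma badd_L_perp: "badd (L_perp_bundle \<mu> x) p u v = u + v"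
  by (simp add: L_perp_bundle_def sub_trivial_def)

lemma coset_at_L: "coset_at (L_perp_bundle \<mu> x) (\<lambda>p. L_space x) p u = translate (L_space x) u"
  by (auto simp: coset_at_def badd_L_perp translate_def)

lemma badd_W:
  "badd (W_bundle \<mu> x) p (translate (L_space x) u) (translate (L_space x) v) =
     translate (L_space x) (u + v)"
  by (simp add: W_bundle_def quotient_bundle_def badd_L_perp translate_add[OF subspace_L])

lemma bscale_W:
  "bscale (W_bundle \<mu> x) p c (translate (L_space x) u) = translate (L_space x) (c *s u)"
proof -
  have "bscale (W_bundle \<mu> x) p c (translate (L_space x) u) =
      {c *s a + b | a b. a \<in> translate (L_space x) u \<and> b \<in> L_space x}"
    by (simp add: W_bundle_def quotient_bundle_def L_perp_bundle_def sub_trivial_def)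
  also have "\<dots> = translate (L_space x) (c *s u)"
    by (intro translate_image[OF subspace_L] vec.subspace_scale[OF subspace_L])
      (auto simp: vec.scale_right_distrib)
  finally show ?thesis .
qed

lemma U_fibre_eq: "U_fibre \<mu> x y p = translate (L_space x) ` U_preimage \<mu> x y"
  by (auto simp: U_fibre_def coset_at_L U_preimage_def pairings_def triple_zero)

abbreviation W_mod_U_coset ::
  "('n::finite \<Rightarrow> complex) \<Rightarrow> complex^'n \<Rightarrow> complex^'n \<Rightarrow> complex^'n \<Rightarrow> (complex^'n) set set" where
  "W_mod_U_coset \<mu> x y \<equiv> iterated_coset (L_space x) (U_preimage \<mu> x y)"

lemma coset_at_U:
  "coset_at (W_bundle \<mu> x) (U_fibre \<mu> x y) p (translate (L_space x) u) = W_mod_U_coset \<mu> x y u"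
proof -
  have "coset_at (W_bundle \<mu> x) (U_fibre \<mu> x y) p (translate (L_space x) u) =
      (\<lambda>k. badd (W_bundle \<mu> x) p (translate (L_space x) u) (translate (L_space x) k)) `
        U_preimage \<mu> x y"
    by (auto simp: coset_at_def U_fibre_eq)
  then show ?thesis
    by (simp add: badd_W iterated_coset_def translate_def[of "U_preimage \<mu> x y"] image_image)
qed

lemma badd_W_mod_U:
  "badd (W_mod_U \<mu> x y) p (W_mod_U_coset \<mu> x y u) (W_mod_U_coset \<mu> x y v) =
     W_mod_U_coset \<mu> x y (u + v)"
proof -
  have "badd (W_mod_U \<mu> x y) p (W_mod_U_coset \<mu> x y u) (W_mod_U_coset \<mu> x y v) =
      translate (L_space x) ` {a + b | a b.
        a \<in> translate (U_preimage \<mu> x y) u \<and> b \<in> translate (U_preimage \<mu> x y) v}"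
    unfolding W_mod_U_def quotient_bundle_def vbundle.simps iterated_coset_def
    by (rule translate_op_image) (simp add: badd_W)
  then show ?thesis
    by (simp add: translate_add[OF subspace_U_preimage] iterated_coset_def)
qed

lemma bscale_W_mod_U:
  "bscale (W_mod_U \<mu> x y) p c (W_mod_U_coset \<mu> x y u) = W_mod_U_coset \<mu> x y (c *s u)"
proof -
  have "bscale (W_mod_U \<mu> x y) p c (W_mod_U_coset \<mu> x y u) =
      translate (L_space x) ` {c *s a + b | a b.
        a \<in> translate (U_preimage \<mu> x y) u \<and> b \<in> U_preimage \<mu> x y}"
    unfolding W_mod_U_def quotient_bundle_def vbundle.simps iterated_coset_def U_fibre_eq
    by (rule translate_op_image) (simp add: badd_W bscale_W)
  also have "{c *s a + b | a b. a \<in> translate (U_preimage \<mu> x y) u \<and> b \<in> U_preimage \<mu> x y} =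
      translate (U_preimage \<mu> x y) (c *s u)"
    by (intro translate_image[OF subspace_U_preimage] vec.subspace_scale[OF subspace_U_preimage])
      (auto simp: vec.scale_right_distrib)
  finally show ?thesis by (simp add: iterated_coset_def)
qed

lemma bsects_L_perp:
  "u \<in> bsects (L_perp_bundle \<mu> x) X \<longleftrightarrow> u \<in> extensional X \<and>
     (\<forall>i. regular_on X (\<lambda>p. u p $ i)) \<and> (\<forall>p\<in>X. u p \<in> L_perp \<mu> x p)"
  by (auto simp: L_perp_bundle_def sub_trivial_def)

text \<open>The local lifts through the two quotients combine to one local lift to \<open>L\<^sup>\<bottom>\<close>.\<close>
lemma bsects_W_mod_U:
  "s \<in> bsects (W_mod_U \<mu> x y) X \<longleftrightarrow> s \<in> extensional X \<and>
     (\<forall>p\<in>X. \<exists>Y. openin P1_top Y \<and> p \<in> Y \<and> Y \<subseteq> X \<and>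
        (\<exists>u\<in>bsects (L_perp_bundle \<mu> x) Y. \<forall>q\<in>Y. s q = W_mod_U_coset \<mu> x y (u q)))"
  (is "_ \<longleftrightarrow> _ \<and> (\<forall>p\<in>X. ?lift p)")
proof -
  have W: "t \<in> bsects (W_bundle \<mu> x) Y \<longleftrightarrow> t \<in> extensional Y \<and>
      (\<forall>p\<in>Y. \<exists>Z. openin P1_top Z \<and> p \<in> Z \<and> Z \<subseteq> Y \<and>
        (\<exists>u\<in>bsects (L_perp_bundle \<mu> x) Z. \<forall>q\<in>Z. t q = translate (L_space x) (u q)))" for t Y
    by (simp add: W_bundle_def quotient_bundle_def coset_at_L)
  have "(\<exists>Y. openin P1_top Y \<and> p \<in> Y \<and> Y \<subseteq> X \<and> (\<exists>t\<in>bsects (W_bundle \<mu> x) Y.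
      \<forall>q\<in>Y. s q = coset_at (W_bundle \<mu> x) (U_fibre \<mu> x y) q (t q))) \<longleftrightarrow> ?lift p" for p
  proof
    assume "\<exists>Y. openin P1_top Y \<and> p \<in> Y \<and> Y \<subseteq> X \<and> (\<exists>t\<in>bsects (W_bundle \<mu> x) Y.
      \<forall>q\<in>Y. s q = coset_at (W_bundle \<mu> x) (U_fibre \<mu> x y) q (t q))"
    then obtain Y t where Y: "p \<in> Y" "Y \<subseteq> X" "t \<in> bsects (W_bundle \<mu> x) Y"
        "\<And>q. q \<in> Y \<Longrightarrow> s q = coset_at (W_bundle \<mu> x) (U_fibre \<mu> x y) q (t q)"
      by blast
    obtain Z u where "openin P1_top Z" "p \<in> Z" "Z \<subseteq> Y" "u \<in> bsects (L_perp_bundle \<mu> x) Z"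
        "\<And>q. q \<in> Z \<Longrightarrow> t q = translate (L_space x) (u q)"
      using W[THEN iffD1, OF Y(3), THEN conjunct2, rule_format, OF Y(1)] by metis
    then show "?lift p"
      using Y by (intro exI[of _ Z] conjI bexI[of _ u]) (auto simp: coset_at_U)
  next
    assume "?lift p"
    then obtain Y u where Y: "openin P1_top Y" "p \<in> Y" "Y \<subseteq> X" "u \<in> bsects (L_perp_bundle \<mu> x) Y"
        "\<And>q. q \<in> Y \<Longrightarrow> s q = W_mod_U_coset \<mu> x y (u q)"
      by blast
    have "(\<lambda>q\<in>Y. translate (L_space x) (u q)) \<in> bsects (W_bundle \<mu> x) Y"
      unfolding W using Y(1,4) by (auto intro!: exI[of _ Y] bexI[of _ u])
    then show "\<exists>Y. openin P1_top Y \<and> p \<in> Y \<and> Y \<subseteq> X \<and> (\<exists>t\<in>bsects (W_bundle \<mu> x) Y.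
      \<forall>q\<in>Y. s q = coset_at (W_bundle \<mu> x) (U_fibre \<mu> x y) q (t q))"
      using Y by (intro exI[of _ Y] conjI bexI[of _ "\<lambda>q\<in>Y. translate (L_space x) (u q)"])
        (auto simp: coset_at_U)
  qed
  then show ?thesis
    by (simp add: W_mod_U_def quotient_bundle_def)
qed

section \<open>Linear independence of the three functionals\<close>

text \<open>A relation with \<open>c \<noteq> 0\<close> would put \<open>y\<close> in the span of the other two vectors. Otherwise
  \<open>a + b \<mu>\<^sub>i\<close> vanishes for every \<open>i\<close> with \<open>x\<^sub>i \<noteq> 0\<close>; there are two such \<open>i\<close>, since a vector with a single
  non-zero coordinate is not isotropic, and the \<open>\<mu>\<^sub>i\<close> are distinct.\<close>
lemma independent_conormals:
  fixes \<mu> :: "'n::finite \<Rightarrow> complex" and x y :: "complex^'n"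
  assumes \<mu>: "inj \<mu>" and "x \<noteq> 0" and xx: "(\<Sum>i\<in>UNIV. (x $ i)\<^sup>2) = 0"
    and y: "y \<notin> vec.span {x, \<chi> i. \<mu> i * x $ i}"
    and lin: "a *s x + b *s (\<chi> i. \<mu> i * x $ i) + c *s y = 0"
  shows "a = 0 \<and> b = 0 \<and> c = 0"
proof -
  have c: "c = 0"
  proof (rule ccontr)
    assume "c \<noteq> 0"
    have "y = (- a / c) *s x + (- b / c) *s (\<chi> i. \<mu> i * x $ i)"
    proof (simp add: vec_eq_iff, intro allI)
      fix i
      have "a * x $ i + b * (\<mu> i * x $ i) + c * y $ i = 0"
        using lin by (simp add: vec_eq_iff)
      then have "c * y $ i = - (a * x $ i) - b * (\<mu> i * x $ i)"
        by algebra
      then show "y $ i = - (a * x $ i / c) - b * (\<mu> i * x $ i) / c"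
        using \<open>c \<noteq> 0\<close> by (metis diff_divide_distrib minus_divide_left nonzero_mult_div_cancel_left)
    qed
    also have "\<dots> \<in> vec.span {x, \<chi> i. \<mu> i * x $ i}"
      by (intro vec.span_add vec.span_scale vec.span_base) auto
    finally show False using y by simp
  qed
  obtain i where i: "x $ i \<noteq> 0"
    using \<open>x \<noteq> 0\<close> by (auto simp: vec_eq_iff)
  have "\<exists>j. j \<noteq> i \<and> x $ j \<noteq> 0"
  proof (rule ccontr)
    assume "\<nexists>j. j \<noteq> i \<and> x $ j \<noteq> 0"
    then have "(\<Sum>j\<in>UNIV. (x $ j)\<^sup>2) = (\<Sum>j\<in>UNIV. if j = i then (x $ i)\<^sup>2 else 0)"
      by (intro sum.cong) auto
    then show False using xx i by simp
  qed
  then obtain j where j: "j \<noteq> i" "x $ j \<noteq> 0" by blast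
  have "(a + b * \<mu> k) * x $ k = 0" for k
    using lin c by (simp add: vec_eq_iff algebra_simps)
  then have "a + b * \<mu> i = 0" "a + b * \<mu> j = 0"
    using i j(2) mult_eq_0_iff by blast+
  then have "b * (\<mu> i - \<mu> j) = 0" by algebra
  then have "b = 0" using injD[OF \<mu>] j(1) by auto
  then show ?thesis using \<open>a + b * \<mu> i = 0\<close> c by simp
qed

lemma exists_dual_vectors:
  fixes f1 f2 f3 :: "complex^'n::finite"
  assumes "\<And>a b c. a *s f1 + b *s f2 + c *s f3 = 0 \<Longrightarrow> a = 0 \<and> b = 0 \<and> c = 0"
  obtains r :: "complex \<Rightarrow> complex \<Rightarrow> complex \<Rightarrow> complex^'n" where
    "\<And>a b c. (\<Sum>i\<in>UNIV. f1 $ i * r a b c $ i) = a"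
    "\<And>a b c. (\<Sum>i\<in>UNIV. f2 $ i * r a b c $ i) = b"
    "\<And>a b c. (\<Sum>i\<in>UNIV. f3 $ i * r a b c $ i) = c"
    "\<And>i. \<exists>k l m. \<forall>a b c. r a b c $ i = k * a + l * b + m * c"
proof -
  let ?M = "vector [f1, f2, f3] :: complex^'n^3"
  have row: "row 1 ?M = f1" "row 2 ?M = f2" "row 3 ?M = f3"
    by (simp_all add: row_def vec_eq_iff)
  have "\<exists>B. ?M ** B = mat 1"
    unfolding matrix_right_invertible_independent_rows
    using assms by (simp add: sum_3 forall_3 row)
  then obtain B where B: "?M ** B = mat 1" by blast
  define r where "r a b c = B *v vector [a, b, c]" for a b c
  have "?M *v r a b c = vector [a, b, c]" for a b c
    by (simp add: r_def matrix_vector_mul_assoc B)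
  then have "(?M *v r a b c) $ k = vector [a, b, c] $ k" for a b c k by simp
  from this[of _ _ _ 1] this[of _ _ _ 2] this[of _ _ _ 3] show ?thesis
    by (intro that[of r])
      (auto simp: matrix_vector_mult_def vector_3, simp add: r_def matrix_vector_mult_def sum_3, blast)
qed

text \<open>A right inverse that does not depend on the point of the line lifts sections of the bundle of triples
  globally.\<close>
lemma pairings_right_inverse:
  fixes \<mu> :: "'n::finite \<Rightarrow> complex" and x y :: "complex^'n"
  assumes "\<And>a b c. a *s x + b *s (\<chi> i. \<mu> i * x $ i) + c *s y = 0 \<Longrightarrow> a = 0 \<and> b = 0 \<and> c = 0"
  obtains r where "\<And>h. pairings \<mu> x y (r h) = h"
    and "\<And>X h i. h \<in> bsects O_plus_O_minus1 X \<Longrightarrow> regular_on X (\<lambda>p. r (h p) $ i)"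
proof -
  obtain r :: "complex \<Rightarrow> complex \<Rightarrow> complex \<Rightarrow> complex^'n" where r:
    "\<And>a b c. (\<Sum>i\<in>UNIV. x $ i * r a b c $ i) = a"
    "\<And>a b c. (\<Sum>i\<in>UNIV. (\<chi> i. \<mu> i * x $ i) $ i * r a b c $ i) = b"
    "\<And>a b c. (\<Sum>i\<in>UNIV. y $ i * r a b c $ i) = c"
    "\<And>i. \<exists>k l m. \<forall>a b c. r a b c $ i = k * a + l * b + m * c"
    by (rule exists_dual_vectors[OF assms]) (assumption, rule that)
  show ?thesis
  proof (rule that)
    let ?r = "\<lambda>h. r (snd h $ 2) (snd h $ 1) (fst h $ 1)"
    show "pairings \<mu> x y (?r h) = h" for h
      using r(1,2,3) by (intro triple_eqI) (simp_all add: pairings_def mult.commute[of _ "y $ _"])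
    fix X h i assume "h \<in> bsects O_plus_O_minus1 X"
    moreover obtain k l m where "\<forall>a b c. r a b c $ i = k * a + l * b + m * c"
      using r(4) by blast
    ultimately show "regular_on X (\<lambda>p. ?r (h p) $ i)"
      by (simp add: bsects_O_plus_O_minus1 regular_on_add regular_on_mult)
  qed
qed

section \<open>W/U as a bundle of triples\<close>

lemma pairings_x:
  assumes "(\<Sum>i\<in>UNIV. (x $ i)\<^sup>2) = 0" "(\<Sum>i\<in>UNIV. \<mu> i * (x $ i)\<^sup>2) = 0"
    "(\<Sum>i\<in>UNIV. x $ i * y $ i) = 0"
  shows "pairings \<mu> x y x = 0"
  using assms by (simp add: pairings_def triple_zero power2_eq_square mult.assoc)

lemma L_subset_U_preimage:
  assumes "pairings \<mu> x y x = 0"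
  shows "L_space x \<subseteq> U_preimage \<mu> x y"
  using assms by (auto simp: L_space_def vec.span_singleton U_preimage_def pairings_scale zero_prod_def)

lemma W_mod_U_coset_eq_iff:
  assumes "pairings \<mu> x y x = 0"
  shows "W_mod_U_coset \<mu> x y u = W_mod_U_coset \<mu> x y v \<longleftrightarrow> pairings \<mu> x y u = pairings \<mu> x y v"
  using iterated_coset_eq_iff[OF subspace_L subspace_U_preimage L_subset_U_preimage[OF assms]]
  by (simp add: U_preimage_def pairings_diff)

text \<open>Two vectors have the same class in \<open>W/U\<close> exactly if their pairings agree. Hence a section of
  \<open>W/U\<close> has well defined pairings; they are regular because they are those of local lifts.\<close>
lemma fibrewise_iso_W_mod_U:
  assumes x: "pairings \<mu> x y x = 0" and r: "\<And>h. pairings \<mu> x y (r h) = h"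
    and reg: "\<And>X h i. h \<in> bsects O_plus_O_minus1 X \<Longrightarrow> regular_on X (\<lambda>p. r (h p) $ i)"
  shows "fibrewise_iso_on UNIV O_plus_O_minus1 (W_mod_U \<mu> x y) (\<lambda>h. W_mod_U_coset \<mu> x y (r h))"
    (is "fibrewise_iso_on _ _ _ ?m")
  unfolding fibrewise_iso_on_def
proof (intro conjI allI impI)
  note eq_iff = W_mod_U_coset_eq_iff[OF x]
  show "?m (badd O_plus_O_minus1 p h h') = badd (W_mod_U \<mu> x y) p (?m h) (?m h')" for p h h'
    by (simp add: badd_W_mod_U eq_iff pairings_add r)
  show "?m (bscale O_plus_O_minus1 p c h) = bscale (W_mod_U \<mu> x y) p c (?m h)" for p c h
    by (simp add: bscale_W_mod_U eq_iff pairings_scale r)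
  fix X :: "P1 set" assume "openin P1_top X \<and> X \<subseteq> UNIV"
  then have X: "openin P1_top X" by simp
  have "inj_on (fibre_map ?m X) (bsects O_plus_O_minus1 X)"
  proof (rule inj_onI)
    fix s t assume st: "s \<in> bsects O_plus_O_minus1 X" "t \<in> bsects O_plus_O_minus1 X"
      and eq: "fibre_map ?m X s = fibre_map ?m X t"
    have "s p = t p" if "p \<in> X" for p
      using fun_cong[OF eq, of p] that by (simp add: eq_iff r)
    then show "s = t"
      using st by (intro extensionalityI[of _ X]) (auto simp: bsects_O_plus_O_minus1)
  qed
  moreover have "fibre_map ?m X h \<in> bsects (W_mod_U \<mu> x y) X" if h: "h \<in> bsects O_plus_O_minus1 X" for h
  proof -
    let ?u = "\<lambda>p\<in>X. r (h p)"
    have "regular_on X (\<lambda>p. ?u p $ i)" for i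
      using reg[OF h] by (simp cong: regular_on_cong)
    moreover have "r (h p) \<in> L_perp \<mu> x p" if "p \<in> X" for p
      using h that by (simp add: L_perp_iff[of _ _ _ _ y] r bsects_O_plus_O_minus1)
    ultimately have "?u \<in> bsects (L_perp_bundle \<mu> x) X"
      by (simp add: bsects_L_perp)
    moreover have "\<forall>q\<in>X. fibre_map ?m X h q = W_mod_U_coset \<mu> x y (?u q)" by simp
    ultimately have "\<exists>Y. openin P1_top Y \<and> p \<in> Y \<and> Y \<subseteq> X \<and> (\<exists>u\<in>bsects (L_perp_bundle \<mu> x) Y.
        \<forall>q\<in>Y. fibre_map ?m X h q = W_mod_U_coset \<mu> x y (u q))" if "p \<in> X" for p
      using X that by (intro exI[of _ X] conjI bexI[of _ ?u]) simp_all
    then show ?thesis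
      unfolding bsects_W_mod_U by (intro conjI ballI) (simp add: fibre_map_def)
  qed
  moreover have "s \<in> fibre_map ?m X ` bsects O_plus_O_minus1 X" if s: "s \<in> bsects (W_mod_U \<mu> x y) X" for s
  proof -
    have "\<forall>p\<in>X. \<exists>u. s p = W_mod_U_coset \<mu> x y u"
      using s unfolding bsects_W_mod_U by blast
    then have "\<exists>u. \<forall>p\<in>X. s p = W_mod_U_coset \<mu> x y (u p)" by (rule bchoice)
    then obtain u where "\<forall>p\<in>X. s p = W_mod_U_coset \<mu> x y (u p)" by (rule exE)
    then have u: "s p = W_mod_U_coset \<mu> x y (u p)" if "p \<in> X" for p
      using that by (rule bspec)
    define h where "h p = pairings \<mu> x y (u p)" for p
    have loc: "\<exists>Y. openin P1_top Y \<and> p \<in> Y \<and> regular_on Y (\<lambda>q. fst (h q) $ 1) \<and>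
        regular_on Y (\<lambda>q. snd (h q) $ 1) \<and> regular_on Y (\<lambda>q. snd (h q) $ 2) \<and>
        on_tautological_line p (snd (h p) $ 1) (snd (h p) $ 2)" if p: "p \<in> X" for p
    proof -
      obtain Y v where Y: "openin P1_top Y" "p \<in> Y" "Y \<subseteq> X"
        and v: "v \<in> bsects (L_perp_bundle \<mu> x) Y"
        and lift: "\<And>q. q \<in> Y \<Longrightarrow> s q = W_mod_U_coset \<mu> x y (v q)"
        using bsects_W_mod_U[THEN iffD1, OF s, THEN conjunct2, rule_format, OF p] by metis
      have h_v: "h q = pairings \<mu> x y (v q)" if "q \<in> Y" for q
      proof -
        have "W_mod_U_coset \<mu> x y (u q) = W_mod_U_coset \<mu> x y (v q)"
          using u[of q] lift[OF that] that Y(3) by auto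
        then show ?thesis by (simp add: h_def eq_iff)
      qed
      have "on_tautological_line p (snd (h p) $ 1) (snd (h p) $ 2)"
        using v Y(2) h_v by (simp add: bsects_L_perp L_perp_iff[of _ _ _ _ y])
      moreover have "regular_on Y (\<lambda>q. v q $ i)" for i
        using v by (simp add: bsects_L_perp)
      then have "regular_on Y (\<lambda>q. fst (pairings \<mu> x y (v q)) $ 1)"
        "regular_on Y (\<lambda>q. snd (pairings \<mu> x y (v q)) $ 1)"
        "regular_on Y (\<lambda>q. snd (pairings \<mu> x y (v q)) $ 2)"
        unfolding pairings_def triple_simps by (intro regular_intros; simp)+
      ultimately show ?thesis
        using Y by (intro exI[of _ Y]) (simp add: h_v cong: regular_on_cong)
    qed
    have "regular_on X (\<lambda>q. fst (h q) $ 1)" "regular_on X (\<lambda>q. snd (h q) $ 1)"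
      "regular_on X (\<lambda>q. snd (h q) $ 2)"
      by (rule regular_on_local, use loc in blast)+
    then have "restrict h X \<in> bsects O_plus_O_minus1 X"
      using loc unfolding restrict_in_bsects_O_plus_O_minus1 by blast
    moreover have "s = fibre_map ?m X (restrict h X)"
    proof (rule extensionalityI[of _ X])
      show "s p = fibre_map ?m X (restrict h X) p" if "p \<in> X" for p
        using that by (simp add: u eq_iff r h_def)
    qed (use s in \<open>auto simp: bsects_W_mod_U fibre_map_def\<close>)
    ultimately show ?thesis by blast
  qed
  ultimately show "bij_betw (fibre_map ?m X) (bsects O_plus_O_minus1 X) (bsects (W_mod_U \<mu> x y) X)"
    by (auto simp: bij_betw_def)
qed

section \<open>The endomorphism A\<close>

lemma A_matrix_apply:
  "(A_matrix \<mu> x y z *v u) $ i =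
     (x $ i * fst (pairings \<mu> x y u) $ 1 - y $ i * snd (pairings \<mu> x y u) $ 2) / (z - \<mu> i)"
  by (simp add: A_matrix_def matrix_vector_mult_def pairings_def sum_distrib_left
      sum_subtractf[symmetric] sum_divide_distrib algebra_simps)

text \<open>The pairings of \<open>A u\<close> with \<open>x\<close> and \<open>y\<close> are the coefficients of \<open>\<Phi>\<close> by inspection. The one with
  \<open>(\<mu>\<^sub>i x\<^sub>i)\<close> is \<open>z\<close> times the one with \<open>x\<close> by \<open>\<Sum> x\<^sub>i\<^sup>2 = \<Sum> x\<^sub>i y\<^sub>i = 0\<close>, which says that \<open>A u\<close> is in
  \<open>L\<^sup>\<bottom>\<close>.\<close>
lemma pairings_A_matrix:
  assumes "z \<notin> range \<mu>" and xx: "(\<Sum>i\<in>UNIV. (x $ i)\<^sup>2) = 0" and xy: "(\<Sum>i\<in>UNIV. x $ i * y $ i) = 0"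
  shows "pairings \<mu> x y (A_matrix \<mu> x y z *v u) = Phi_on_triples \<mu> x y z (pairings \<mu> x y u)"
proof (rule triple_eqI)
  let ?c = "fst (pairings \<mu> x y u) $ 1" and ?a = "snd (pairings \<mu> x y u) $ 2"
  let ?S = "pole_sum \<mu>"
  let ?Au = "A_matrix \<mu> x y z *v u"
  show "fst (pairings \<mu> x y ?Au) $ 1 = fst (Phi_on_triples \<mu> x y z (pairings \<mu> x y u)) $ 1"
    by (simp add: pairings_def[of _ _ _ ?Au] Phi_on_triples_def Let_def A_matrix_apply pole_sum_def
        sum_distrib_left sum_subtractf[symmetric] diff_divide_distrib power2_eq_square algebra_simps)
  show "snd (pairings \<mu> x y ?Au) $ 2 = snd (Phi_on_triples \<mu> x y z (pairings \<mu> x y u)) $ 2"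
    by (simp add: pairings_def[of _ _ _ ?Au] Phi_on_triples_def Let_def A_matrix_apply pole_sum_def
        sum_distrib_left sum_subtractf[symmetric] diff_divide_distrib power2_eq_square algebra_simps)
  have "snd (pairings \<mu> x y ?Au) $ 1 =
      ?c * ?S (\<lambda>i. \<mu> i * (x $ i)\<^sup>2) z - ?a * ?S (\<lambda>i. \<mu> i * (x $ i * y $ i)) z"
    by (simp add: pairings_def[of _ _ _ ?Au] A_matrix_apply pole_sum_def
        sum_distrib_left sum_subtractf[symmetric] diff_divide_distrib power2_eq_square algebra_simps)
  also have "\<dots> = snd (Phi_on_triples \<mu> x y z (pairings \<mu> x y u)) $ 1"
    by (simp add: mult_pole_sum[OF assms(1) xx, symmetric] mult_pole_sum[OF assms(1) xy, symmetric]
        Phi_on_triples_def Let_def algebra_simps)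
  finally show "snd (pairings \<mu> x y ?Au) $ 1 = snd (Phi_on_triples \<mu> x y z (pairings \<mu> x y u)) $ 1" .
qed

text \<open>\<open>A u\<close> depends only on the pairings of \<open>u\<close>, so \<open>A\<close> kills \<open>L\<close> and the preimage of \<open>U\<close>.\<close>
lemma Psi_coset:
  assumes "pairings \<mu> x y x = 0"
  shows "Psi \<mu> x y z (W_mod_U_coset \<mu> x y u) = W_mod_U_coset \<mu> x y (A_matrix \<mu> x y z *v u)"
proof -
  let ?A = "\<lambda>u. A_matrix \<mu> x y z *v u"
  have kernel: "?A k = 0" if "k \<in> U_preimage \<mu> x y" for k
    using that by (simp add: vec_eq_iff A_matrix_apply U_preimage_def)
  have A_on_W: "A_on_W \<mu> x y z (translate (L_space x) u) = translate (L_space x) (?A u)" for u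
  proof -
    have "A_on_W \<mu> x y z (translate (L_space x) u) =
        {?A a + b | a b. a \<in> translate (L_space x) u \<and> b \<in> L_space x}"
      by (simp add: A_on_W_def quotient_endo_def badd_L_perp)
    also have "\<dots> = translate (L_space x) (?A u)"
      using kernel L_subset_U_preimage[OF assms] vec.subspace_0[OF subspace_L, of x]
      by (intro translate_image[OF subspace_L]) (auto simp: matrix_vector_right_distrib)
    finally show ?thesis .
  qed
  have "Psi \<mu> x y z (W_mod_U_coset \<mu> x y u) = translate (L_space x) ` {?A a + b | a b.
      a \<in> translate (U_preimage \<mu> x y) u \<and> b \<in> U_preimage \<mu> x y}"
    unfolding Psi_def quotient_endo_def iterated_coset_def U_fibre_eq
    by (rule translate_op_image) (simp add: A_on_W badd_W)
  also have "{?A a + b | a b. a \<in> translate (U_preimage \<mu> x y) u \<and> b \<in> U_preimage \<mu> x y} =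
      translate (U_preimage \<mu> x y) (?A u)"
    using kernel vec.subspace_0[OF subspace_U_preimage]
    by (intro translate_image[OF subspace_U_preimage]) (auto simp: matrix_vector_right_distrib)
  finally show ?thesis by (simp add: iterated_coset_def)
qed

section \<open>The equivalence of the Higgs fields\<close>

theorem proposition2:
  fixes g :: nat
    and \<mu> :: "'n::finite \<Rightarrow> complex"
    and x y :: "complex^'n"
  assumes "g \<ge> 1"
    and "CARD('n) = 2 * g + 2"
    and "inj \<mu>"
    and "x \<noteq> 0"
    and "(\<Sum>i\<in>UNIV. (x $ i)\<^sup>2) = 0"
    and "(\<Sum>i\<in>UNIV. \<mu> i * (x $ i)\<^sup>2) = 0"
    and "(\<Sum>i\<in>UNIV. x $ i * y $ i) = 0"
    and "(\<Sum>i\<in>UNIV. (y $ i)\<^sup>2) = - 1"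
    and cotangent_vector_nonzero: "y \<notin> vec.span {x, \<chi> i. \<mu> i * x $ i}"
  shows "rank2_bundle (W_mod_U \<mu> x y)
       \<and> higgs_field (W_mod_U \<mu> x y) (range \<mu>) (Psi \<mu> x y)
       \<and> rank2_bundle E_bundle
       \<and> (\<exists>\<phi>. bundle_iso E_bundle (bundle_sum O_bundle O_minus1_bundle) \<phi>)
       \<and> higgs_field E_bundle (range \<mu>) (Phi \<mu> x y)
       \<and> higgs_equivalent (range \<mu>) (W_mod_U \<mu> x y) (Psi \<mu> x y) E_bundle (Phi \<mu> x y)"
proof -
  note xx = assms(5) and \<mu>xx = assms(6) and xy = assms(7)
  have x: "pairings \<mu> x y x = 0"
    by (rule pairings_x[OF xx \<mu>xx xy])
  obtain r where r: "\<And>h. pairings \<mu> x y (r h) = h"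
    and "\<And>X h i. h \<in> bsects O_plus_O_minus1 X \<Longrightarrow> regular_on X (\<lambda>p. r (h p) $ i)"
    by (rule pairings_right_inverse[where \<mu> = \<mu> and x = x and y = y,
          OF independent_conormals[OF assms(3,4) xx cotangent_vector_nonzero]])
      (assumption, (rule that; assumption))
  then have isoW: "fibrewise_iso_on UNIV O_plus_O_minus1 (W_mod_U \<mu> x y) (\<lambda>h. W_mod_U_coset \<mu> x y (r h))"
    by (intro fibrewise_iso_W_mod_U x)
  have Psi: "Psi \<mu> x y z (W_mod_U_coset \<mu> x y (r h)) = W_mod_U_coset \<mu> x y (r (Phi_on_triples \<mu> x y z h))"
    if "z \<notin> range \<mu>" for z h
    by (simp add: Psi_coset[OF x] W_mod_U_coset_eq_iff[OF x] pairings_A_matrix[OF that xx xy] r)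
  note hub = module_sheaf_O_plus_O_minus1 and higgs = higgs_field_Phi_on_triples[OF xx \<mu>xx xy]
  note isoE = fibrewise_iso_E
  have D: "finite (range \<mu>)" by simp
  show ?thesis
  proof (intro conjI exI)
    show "rank2_bundle (W_mod_U \<mu> x y)"
      by (rule locally_free_transfer[OF hub bundle_iso_on_fibre_map[OF isoW] rank2_O_plus_O_minus1])
    show "rank2_bundle E_bundle"
      by (rule locally_free_transfer[OF hub bundle_iso_on_fibre_map[OF isoE] rank2_O_plus_O_minus1])
    show "bundle_iso E_bundle O_plus_O_minus1
        (\<lambda>X. inv_into (bsects O_plus_O_minus1 X) (fibre_map E_projection X))"
      by (rule bundle_iso_on_inverse[OF hub bundle_iso_on_fibre_map[OF isoE]])
    show "higgs_field (W_mod_U \<mu> x y) (range \<mu>) (Psi \<mu> x y)"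
      by (rule higgs_field_transfer[OF isoW higgs D]) (rule Psi)
    show "higgs_field E_bundle (range \<mu>) (Phi \<mu> x y)"
      by (rule higgs_field_transfer[OF isoE higgs D]) (rule Phi_E_projection)
    show "higgs_equivalent (range \<mu>) (W_mod_U \<mu> x y) (Psi \<mu> x y) E_bundle (Phi \<mu> x y)"
      by (rule higgs_equivalent_fibrewise_span[OF hub higgs D isoW _ isoE]) (erule Psi, rule Phi_E_projection)
  qed
qed

end
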